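(* Let $\mathcal A=\langle A,T,Q,\gamma,\eta,\varepsilon\rangle$ be a skew monoidal monoid with associated right $A$-bialgebroid $G=\mu T(A)$ and left $A$-bialgebroid $F=Q(A)\delta$. The left dual $G^*=\mathrm{Hom}(G_A,A_A)$ of the right $A$-bialgebroid $G$ can be identified with the left $A$-bialgebroid $F$ (via $f\mapsto\langle f,-\rangle$) by the non-degenerate pairing $$\langle-,-\rangle:F\times G\to A,\qquad\langle f,g\rangle:=\varepsilon fg\eta,$$ which satisfies, for all $f,f'\in F$, $g,g'\in G$, $a_1,a_2\in A$, $$\langle f,a_1\cdot g\cdot a_2\rangle=\langle fQ(a_1),g\rangle a_2,\qquad \langle a_1\cdot f\cdot a_2,g\rangle=a_1\langle f,T(a_2)g\rangle,$$ $$\langle f,gg'\rangle=\langle f_{(1)}\cdot\langle f_{(2)},g\rangle,g'\rangle,\qquad \langle ff',g\rangle=\langle f,\langle f',g^{(1)}\rangle\cdot g^{(2)}\rangle,$$ $$\langle f,1_G\rangle=\varepsilon f\eta,\qquad\langle 1_F,g\rangle=\varepsilon g\eta.$$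
   Context: A skew monoidal monoid $\mathcal A=\langle A,T,Q,\gamma,\eta,\varepsilon\rangle$ consists of a monoid $A$, monoid endomorphisms $T,Q:A\to A$ and elements $\gamma,\eta,\varepsilon\in A$ such that for all $a,b\in A$: $T(a)Q(b)=Q(b)T(a)$, $\gamma T^2(a)=T(a)\gamma$, $\gamma TQ(a)=QT(a)\gamma$, $\gamma Q(a)=Q^2(a)\gamma$, $\eta a=T(a)\eta$, $a\varepsilon=\varepsilon Q(a)$, $Q(\gamma)\gamma T(\gamma)=\gamma^2$, $\gamma\eta=Q(\eta)$, $\varepsilon\gamma=T(\varepsilon)$, $Q(\varepsilon)\gamma T(\eta)=1$, $\varepsilon\eta=1$. Put $\mu:=Q(\varepsilon)\gamma$, $\delta:=\gamma T(\eta)$ (then $\gamma=\mu\delta$) and $S:A\to A^{\mathrm{op}}$, $S(a):=\mu T(Q(a)\eta)$, a monoid morphism. $G=\mu T(A)$ is a submonoid of $A$ and a right $A$-bialgebroid with source $s^G(a)=T(a)$, target $t^G(a)=S(a)$, bimodule structure $a_1\cdot g\cdot a_2=gS(a_1)T(a_2)$, comultiplication $\Delta^G(g)=g^{(1)}\otimes g^{(2)}=\mu\otimes_A\mu T(\delta g\eta)$ and counit $\epsilon^G(g)=\varepsilon g\eta$. $F=Q(A)\delta$ is a submonoid of $A$ and a left $A$-bialgebroid with source $s_F(a)=Q(a)$, target $t_F(a)=S(a)$, bimodule structure $a_1\cdot f\cdot a_2=Q(a_1)S(a_2)f$, comultiplication $\Delta_F(f)=f_{(1)}\otimes f_{(2)}=Q(\varepsilon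 f\mu)\delta\otimes_A\delta$ and counit $\epsilon_F(f)=\varepsilon f\eta$. The left dual $G^*=\mathrm{Hom}(G_A,A_A)$ is the set of right $A$-set maps $\varphi:G\to A$, i.e. $\varphi(gT(a))=\varphi(g)a$. Its left $A$-bialgebroid structure is: product $(\varphi\varphi')(g)=\varphi(\varphi'(g^{(1)})\cdot g^{(2)})$, unit $\epsilon^G$, source $s(a)(g)=a\,\epsilon^G(g)$, target $t(a)(g)=\epsilon^G(s^G(a)g)$, bimodule structure $a_1\cdot\varphi\cdot a_2=s(a_1)t(a_2)\varphi$, counit $\varphi\mapsto\varphi(1_G)$, and comultiplication determined by $\varphi(gg')=(\varphi_{(1)}\cdot\varphi_{(2)}(g))(g')$. Non-degenerate means that $f\mapsto\langle f,-\rangle$ and $g\mapsto\langle-,g\rangle$ are injective. *)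

theory Defs
  imports "HOL-Algebra.Group"
begin

text \<open>
  All monoids, bimodules and bialgebroids below live in the category of sets. The base monoid
  is a type of class \<open>monoid_mult\<close>; the other structures have explicit carriers.
\<close>

definition generated_equiv :: "'x set \<Rightarrow> ('x \<times> 'x) set \<Rightarrow> ('x \<times> 'x) set" where
  "generated_equiv X R = {(p, q). p \<in> X \<and> q \<in> X \<and> (p, q) \<in> (R \<union> R\<inverse>)\<^sup>*}"

text \<open>
  For a right \<open>A\<close>-set \<open>M\<close> (action \<open>r\<close>) and a left \<open>A\<close>-set \<open>N\<close> (action \<open>l\<close>), the set
  \<open>M \<otimes>\<^sub>A N\<close> is the quotient of \<open>M \<times> N\<close> by the equivalence generated by
  \<open>(x \<cdot> a, y) \<sim> (x, a \<cdot> y)\<close>.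
\<close>

definition tensor_rel ::
    "'x set \<Rightarrow> 'y set \<Rightarrow> ('x \<Rightarrow> 'a \<Rightarrow> 'x) \<Rightarrow> ('a \<Rightarrow> 'y \<Rightarrow> 'y) \<Rightarrow> (('x \<times> 'y) \<times> ('x \<times> 'y)) set" where
  "tensor_rel M N r l =
     generated_equiv (M \<times> N) {((r x a, y), (x, l a y)) | x y a. x \<in> M \<and> y \<in> N}"

definition tensor_prod ::
    "'x set \<Rightarrow> 'y set \<Rightarrow> ('x \<Rightarrow> 'a \<Rightarrow> 'x) \<Rightarrow> ('a \<Rightarrow> 'y \<Rightarrow> 'y) \<Rightarrow> ('x \<times> 'y) set set" where
  "tensor_prod M N r l = (M \<times> N) // tensor_rel M N r l"

definition pure_tensor ::
    "'x set \<Rightarrow> 'y set \<Rightarrow> ('x \<Rightarrow> 'a \<Rightarrow> 'x) \<Rightarrow> ('a \<Rightarrow> 'y \<Rightarrow> 'y) \<Rightarrow> 'x \<Rightarrow> 'y \<Rightarrow> ('x \<times> 'y) set" where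
  "pure_tensor M N r l x y = tensor_rel M N r l `` {(x, y)}"

text \<open>The class of \<open>x \<otimes> y \<otimes> z\<close> in \<open>M \<otimes>\<^sub>A M \<otimes>\<^sub>A M\<close> for a bimodule \<open>M\<close>.\<close>

definition pure_tensor3 ::
    "'x set \<Rightarrow> ('x \<Rightarrow> 'a \<Rightarrow> 'x) \<Rightarrow> ('a \<Rightarrow> 'x \<Rightarrow> 'x) \<Rightarrow> 'x \<Rightarrow> 'x \<Rightarrow> 'x \<Rightarrow> ('x \<times> 'x \<times> 'x) set" where
  "pure_tensor3 M r l x y z =
     generated_equiv (M \<times> M \<times> M)
       ({((r x a, y, z), (x, l a y, z)) | x y z a. x \<in> M \<and> y \<in> M \<and> z \<in> M} \<union>
        {((x, r y a, z), (x, y, l a z)) | x y z a. x \<in> M \<and> y \<in> M \<and> z \<in> M}) `` {(x, y, z)}"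

text \<open>
  The function on a tensor product induced by \<open>h\<close>; meaningful only if \<open>h\<close> is constant on
  the class \<open>X\<close>, i.e. balanced.
\<close>

definition tensor_lift :: "('x \<Rightarrow> 'y \<Rightarrow> 'z) \<Rightarrow> ('x \<times> 'y) set \<Rightarrow> 'z" where
  "tensor_lift h X = the_elem ((\<lambda>(x, y). h x y) ` X)"

record ('a, 'b) bialgebroid = "'b monoid" +
  src :: "'a \<Rightarrow> 'b"
  tgt :: "'a \<Rightarrow> 'b"
  comult :: "'b \<Rightarrow> ('b \<times> 'b) set"
  counit :: "'b \<Rightarrow> 'a"

text \<open>
  The bimodule structure of a right bialgebroid is \<open>a\<^sub>1 \<cdot> g \<cdot> a\<^sub>2 = g t(a\<^sub>1) s(a\<^sub>2)\<close>; that of a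
  left bialgebroid is \<open>a\<^sub>1 \<cdot> f \<cdot> a\<^sub>2 = s(a\<^sub>1) t(a\<^sub>2) f\<close>.
\<close>

definition rb_lact :: "('a, 'b) bialgebroid \<Rightarrow> 'a \<Rightarrow> 'b \<Rightarrow> 'b" where
  "rb_lact B a g = g \<otimes>\<^bsub>B\<^esub> tgt B a"

definition rb_ract :: "('a, 'b) bialgebroid \<Rightarrow> 'b \<Rightarrow> 'a \<Rightarrow> 'b" where
  "rb_ract B g a = g \<otimes>\<^bsub>B\<^esub> src B a"

abbreviation rb_tensor :: "('a, 'b) bialgebroid \<Rightarrow> 'b \<Rightarrow> 'b \<Rightarrow> ('b \<times> 'b) set" where
  "rb_tensor B \<equiv> pure_tensor (carrier B) (carrier B) (rb_ract B) (rb_lact B)"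

abbreviation rb_tensor3 :: "('a, 'b) bialgebroid \<Rightarrow> 'b \<Rightarrow> 'b \<Rightarrow> 'b \<Rightarrow> ('b \<times> 'b \<times> 'b) set" where
  "rb_tensor3 B \<equiv> pure_tensor3 (carrier B) (rb_ract B) (rb_lact B)"

text \<open>
  Sweedler's notation is rendered by quantifying over all representatives \<open>(x, y)\<close> of
  \<open>\<Delta>(g)\<close>, which is a nonempty set by \<open>comult_closed\<close>.
\<close>

locale right_bialgebroid = monoid B for B :: "('a::monoid_mult, 'b) bialgebroid" (structure) +
  assumes src_closed: "src B a \<in> carrier B"
    and src_one: "src B 1 = \<one>"
    and src_mult: "src B (a * b) = src B a \<otimes> src B b"
    and tgt_closed: "tgt B a \<in> carrier B"
    and tgt_one: "tgt B 1 = \<one>"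
    and tgt_mult: "tgt B (a * b) = tgt B b \<otimes> tgt B a"
    and src_tgt_commute: "src B a \<otimes> tgt B b = tgt B b \<otimes> src B a"
    and comult_closed: "g \<in> carrier B \<Longrightarrow>
      comult B g \<in> tensor_prod (carrier B) (carrier B) (rb_ract B) (rb_lact B)"
    and comult_bimodule: "\<lbrakk>g \<in> carrier B; (x, y) \<in> comult B g\<rbrakk> \<Longrightarrow>
      comult B (rb_ract B (rb_lact B a g) b) = rb_tensor B (rb_lact B a x) (rb_ract B y b)"
    and counit_bimodule: "g \<in> carrier B \<Longrightarrow>
      counit B (rb_ract B (rb_lact B a g) b) = a * counit B g * b"
    and coassoc: "\<lbrakk>g \<in> carrier B; (x, y) \<in> comult B g; (x1, x2) \<in> comult B x;
        (u, v) \<in> comult B g; (v1, v2) \<in> comult B v\<rbrakk> \<Longrightarrow>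
      rb_tensor3 B x1 x2 y = rb_tensor3 B u v1 v2"
    and counit_left: "\<lbrakk>g \<in> carrier B; (x, y) \<in> comult B g\<rbrakk> \<Longrightarrow> rb_lact B (counit B x) y = g"
    and counit_right: "\<lbrakk>g \<in> carrier B; (x, y) \<in> comult B g\<rbrakk> \<Longrightarrow> rb_ract B x (counit B y) = g"
    and takeuchi: "\<lbrakk>g \<in> carrier B; (x, y) \<in> comult B g\<rbrakk> \<Longrightarrow>
      rb_tensor B (src B a \<otimes> x) y = rb_tensor B x (tgt B a \<otimes> y)"
    and comult_one: "comult B \<one> = rb_tensor B \<one> \<one>"
    and comult_mult: "\<lbrakk>g \<in> carrier B; g' \<in> carrier B; (x, y) \<in> comult B g; (x', y') \<in> comult B g'\<rbrakk>
      \<Longrightarrow> comult B (g \<otimes> g') = rb_tensor B (x \<otimes> x') (y \<otimes> y')"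
    and counit_one: "counit B \<one> = 1"
    and counit_mult_src: "\<lbrakk>g \<in> carrier B; g' \<in> carrier B\<rbrakk> \<Longrightarrow>
      counit B (g \<otimes> g') = counit B (src B (counit B g) \<otimes> g')"
    and counit_mult_tgt: "\<lbrakk>g \<in> carrier B; g' \<in> carrier B\<rbrakk> \<Longrightarrow>
      counit B (g \<otimes> g') = counit B (tgt B (counit B g) \<otimes> g')"

definition lb_lact :: "('a, 'b) bialgebroid \<Rightarrow> 'a \<Rightarrow> 'b \<Rightarrow> 'b" where
  "lb_lact B a f = src B a \<otimes>\<^bsub>B\<^esub> f"

definition lb_ract :: "('a, 'b) bialgebroid \<Rightarrow> 'b \<Rightarrow> 'a \<Rightarrow> 'b" where
  "lb_ract B f a = tgt B a \<otimes>\<^bsub>B\<^esub> f"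

abbreviation lb_tensor :: "('a, 'b) bialgebroid \<Rightarrow> 'b \<Rightarrow> 'b \<Rightarrow> ('b \<times> 'b) set" where
  "lb_tensor B \<equiv> pure_tensor (carrier B) (carrier B) (lb_ract B) (lb_lact B)"

abbreviation lb_tensor3 :: "('a, 'b) bialgebroid \<Rightarrow> 'b \<Rightarrow> 'b \<Rightarrow> 'b \<Rightarrow> ('b \<times> 'b \<times> 'b) set" where
  "lb_tensor3 B \<equiv> pure_tensor3 (carrier B) (lb_ract B) (lb_lact B)"

locale left_bialgebroid = monoid B for B :: "('a::monoid_mult, 'b) bialgebroid" (structure) +
  assumes src_closed: "src B a \<in> carrier B"
    and src_one: "src B 1 = \<one>"
    and src_mult: "src B (a * b) = src B a \<otimes> src B b"
    and tgt_closed: "tgt B a \<in> carrier B"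
    and tgt_one: "tgt B 1 = \<one>"
    and tgt_mult: "tgt B (a * b) = tgt B b \<otimes> tgt B a"
    and src_tgt_commute: "src B a \<otimes> tgt B b = tgt B b \<otimes> src B a"
    and comult_closed: "f \<in> carrier B \<Longrightarrow>
      comult B f \<in> tensor_prod (carrier B) (carrier B) (lb_ract B) (lb_lact B)"
    and comult_bimodule: "\<lbrakk>f \<in> carrier B; (x, y) \<in> comult B f\<rbrakk> \<Longrightarrow>
      comult B (lb_ract B (lb_lact B a f) b) = lb_tensor B (lb_lact B a x) (lb_ract B y b)"
    and counit_bimodule: "f \<in> carrier B \<Longrightarrow>
      counit B (lb_ract B (lb_lact B a f) b) = a * counit B f * b"
    and coassoc: "\<lbrakk>f \<in> carrier B; (x, y) \<in> comult B f; (x1, x2) \<in> comult B x;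
        (u, v) \<in> comult B f; (v1, v2) \<in> comult B v\<rbrakk> \<Longrightarrow>
      lb_tensor3 B x1 x2 y = lb_tensor3 B u v1 v2"
    and counit_left: "\<lbrakk>f \<in> carrier B; (x, y) \<in> comult B f\<rbrakk> \<Longrightarrow> lb_lact B (counit B x) y = f"
    and counit_right: "\<lbrakk>f \<in> carrier B; (x, y) \<in> comult B f\<rbrakk> \<Longrightarrow> lb_ract B x (counit B y) = f"
    and takeuchi: "\<lbrakk>f \<in> carrier B; (x, y) \<in> comult B f\<rbrakk> \<Longrightarrow>
      lb_tensor B (x \<otimes> tgt B a) y = lb_tensor B x (y \<otimes> src B a)"
    and comult_one: "comult B \<one> = lb_tensor B \<one> \<one>"
    and comult_mult: "\<lbrakk>f \<in> carrier B; f' \<in> carrier B; (x, y) \<in> comult B f; (x', y') \<in> comult B f'\<rbrakk>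
      \<Longrightarrow> comult B (f \<otimes> f') = lb_tensor B (x \<otimes> x') (y \<otimes> y')"
    and counit_one: "counit B \<one> = 1"
    and counit_mult_src: "\<lbrakk>f \<in> carrier B; f' \<in> carrier B\<rbrakk> \<Longrightarrow>
      counit B (f \<otimes> f') = counit B (f \<otimes> src B (counit B f'))"
    and counit_mult_tgt: "\<lbrakk>f \<in> carrier B; f' \<in> carrier B\<rbrakk> \<Longrightarrow>
      counit B (f \<otimes> f') = counit B (f \<otimes> tgt B (counit B f'))"

text \<open>Isomorphisms of left bialgebroids over the same base, identical on the base.\<close>

definition left_bialgebroid_iso ::
    "('a::monoid_mult, 'b) bialgebroid \<Rightarrow> ('a, 'c) bialgebroid \<Rightarrow> ('b \<Rightarrow> 'c) \<Rightarrow> bool" where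
  "left_bialgebroid_iso L M h \<longleftrightarrow>
     left_bialgebroid L \<and> left_bialgebroid M \<and>
     h \<in> iso L M \<and>
     h \<one>\<^bsub>L\<^esub> = \<one>\<^bsub>M\<^esub> \<and>
     (\<forall>a. h (src L a) = src M a) \<and>
     (\<forall>a. h (tgt L a) = tgt M a) \<and>
     (\<forall>f\<in>carrier L. \<forall>(x, y)\<in>comult L f. comult M (h f) = lb_tensor M (h x) (h y)) \<and>
     (\<forall>f\<in>carrier L. counit M (h f) = counit L f)"

text \<open>
  Right \<open>A\<close>-set maps \<open>G \<rightarrow> A\<close>; extensionality makes equality of such maps equality on
  the carrier.
\<close>

definition dual_carrier :: "('a::monoid_mult, 'b) bialgebroid \<Rightarrow> ('b \<Rightarrow> 'a) set" where
  "dual_carrier G =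
     {\<phi> \<in> extensional (carrier G). \<forall>g\<in>carrier G. \<forall>a. \<phi> (rb_ract G g a) = \<phi> g * a}"

definition dual_mult ::
    "('a::monoid_mult, 'b) bialgebroid \<Rightarrow> ('b \<Rightarrow> 'a) \<Rightarrow> ('b \<Rightarrow> 'a) \<Rightarrow> ('b \<Rightarrow> 'a)" where
  "dual_mult G \<phi> \<phi>' =
     (\<lambda>g\<in>carrier G. tensor_lift (\<lambda>g1 g2. \<phi> (rb_lact G (\<phi>' g1) g2)) (comult G g))"

definition dual_src :: "('a::monoid_mult, 'b) bialgebroid \<Rightarrow> 'a \<Rightarrow> ('b \<Rightarrow> 'a)" where
  "dual_src G a = (\<lambda>g\<in>carrier G. a * counit G g)"

definition dual_tgt :: "('a::monoid_mult, 'b) bialgebroid \<Rightarrow> 'a \<Rightarrow> ('b \<Rightarrow> 'a)" where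
  "dual_tgt G a = (\<lambda>g\<in>carrier G. counit G (src G a \<otimes>\<^bsub>G\<^esub> g))"

definition dual_lact ::
    "('a::monoid_mult, 'b) bialgebroid \<Rightarrow> 'a \<Rightarrow> ('b \<Rightarrow> 'a) \<Rightarrow> ('b \<Rightarrow> 'a)" where
  "dual_lact G a \<phi> = dual_mult G (dual_src G a) \<phi>"

definition dual_ract ::
    "('a::monoid_mult, 'b) bialgebroid \<Rightarrow> ('b \<Rightarrow> 'a) \<Rightarrow> 'a \<Rightarrow> ('b \<Rightarrow> 'a)" where
  "dual_ract G \<phi> a = dual_mult G (dual_tgt G a) \<phi>"

text \<open>
  \<open>X\<close> is a value of the comultiplication at \<open>\<phi>\<close>:
  \<open>\<phi>(g g') = (\<phi>\<^sub>1 \<cdot> \<phi>\<^sub>2(g))(g')\<close> for \<open>X = \<phi>\<^sub>1 \<otimes> \<phi>\<^sub>2\<close>.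
\<close>

definition is_dual_comult ::
    "('a::monoid_mult, 'b) bialgebroid \<Rightarrow> ('b \<Rightarrow> 'a) \<Rightarrow> (('b \<Rightarrow> 'a) \<times> ('b \<Rightarrow> 'a)) set \<Rightarrow> bool" where
  "is_dual_comult G \<phi> X \<longleftrightarrow>
     X \<in> tensor_prod (dual_carrier G) (dual_carrier G) (dual_ract G) (dual_lact G) \<and>
     (\<forall>(\<phi>1, \<phi>2)\<in>X. \<forall>g\<in>carrier G. \<forall>g'\<in>carrier G.
        \<phi> (g \<otimes>\<^bsub>G\<^esub> g') = dual_ract G \<phi>1 (\<phi>2 g) g')"

definition left_dual :: "('a::monoid_mult, 'b) bialgebroid \<Rightarrow> ('a, 'b \<Rightarrow> 'a) bialgebroid" where
  "left_dual G =
     \<lparr>carrier = dual_carrier G,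
      mult = dual_mult G,
      one = restrict (counit G) (carrier G),
      src = dual_src G,
      tgt = dual_tgt G,
      comult = (\<lambda>\<phi>. THE X. is_dual_comult G \<phi> X),
      counit = (\<lambda>\<phi>. \<phi> \<one>\<^bsub>G\<^esub>)\<rparr>"

locale skew_monoidal_monoid =
  fixes T Q :: "'a::monoid_mult \<Rightarrow> 'a" and \<gamma> \<eta> \<epsilon> :: 'a
  assumes T_one: "T 1 = 1" and T_mult: "T (a * b) = T a * T b"
    and Q_one: "Q 1 = 1" and Q_mult: "Q (a * b) = Q a * Q b"
    and T_Q_commute: "T a * Q b = Q b * T a"
    and gamma_TT: "\<gamma> * T (T a) = T a * \<gamma>"
    and gamma_TQ: "\<gamma> * T (Q a) = Q (T a) * \<gamma>"
    and gamma_Q: "\<gamma> * Q a = Q (Q a) * \<gamma>"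
    and eta_natural: "\<eta> * a = T a * \<eta>"
    and eps_natural: "a * \<epsilon> = \<epsilon> * Q a"
    and pentagon: "Q \<gamma> * \<gamma> * T \<gamma> = \<gamma> * \<gamma>"
    and gamma_eta: "\<gamma> * \<eta> = Q \<eta>"
    and eps_gamma: "\<epsilon> * \<gamma> = T \<epsilon>"
    and Qeps_gamma_Teta: "Q \<epsilon> * \<gamma> * T \<eta> = 1"
    and eps_eta: "\<epsilon> * \<eta> = 1"

definition smm_mu :: "('a::monoid_mult \<Rightarrow> 'a) \<Rightarrow> 'a \<Rightarrow> 'a \<Rightarrow> 'a" where
  "smm_mu Q \<gamma> \<epsilon> = Q \<epsilon> * \<gamma>"

definition smm_delta :: "('a::monoid_mult \<Rightarrow> 'a) \<Rightarrow> 'a \<Rightarrow> 'a \<Rightarrow> 'a" where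
  "smm_delta T \<gamma> \<eta> = \<gamma> * T \<eta>"

definition smm_S ::
    "('a::monoid_mult \<Rightarrow> 'a) \<Rightarrow> ('a \<Rightarrow> 'a) \<Rightarrow> 'a \<Rightarrow> 'a \<Rightarrow> 'a \<Rightarrow> 'a \<Rightarrow> 'a" where
  "smm_S T Q \<gamma> \<eta> \<epsilon> a = smm_mu Q \<gamma> \<epsilon> * T (Q a * \<eta>)"

text \<open>
  The two actions used in the comultiplications of \<open>smm_G\<close> and \<open>smm_F\<close> are \<open>rb_ract\<close>, \<open>rb_lact\<close>
  and \<open>lb_ract\<close>, \<open>lb_lact\<close> of the structure being defined, written out.
\<close>

definition smm_G ::
    "('a::monoid_mult \<Rightarrow> 'a) \<Rightarrow> ('a \<Rightarrow> 'a) \<Rightarrow> 'a \<Rightarrow> 'a \<Rightarrow> 'a \<Rightarrow> ('a, 'a) bialgebroid" where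
  "smm_G T Q \<gamma> \<eta> \<epsilon> =
     (let \<mu> = smm_mu Q \<gamma> \<epsilon>; \<delta> = smm_delta T \<gamma> \<eta>; S = smm_S T Q \<gamma> \<eta> \<epsilon>;
          C = range (\<lambda>a. \<mu> * T a)
      in \<lparr>carrier = C,
          mult = (*),
          one = 1,
          src = T,
          tgt = S,
          comult = (\<lambda>g. pure_tensor C C (\<lambda>g a. g * T a) (\<lambda>a g. g * S a) \<mu> (\<mu> * T (\<delta> * g * \<eta>))),
          counit = (\<lambda>g. \<epsilon> * g * \<eta>)\<rparr>)"

definition smm_F ::
    "('a::monoid_mult \<Rightarrow> 'a) \<Rightarrow> ('a \<Rightarrow> 'a) \<Rightarrow> 'a \<Rightarrow> 'a \<Rightarrow> 'a \<Rightarrow> ('a, 'a) bialgebroid" where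
  "smm_F T Q \<gamma> \<eta> \<epsilon> =
     (let \<mu> = smm_mu Q \<gamma> \<epsilon>; \<delta> = smm_delta T \<gamma> \<eta>; S = smm_S T Q \<gamma> \<eta> \<epsilon>;
          C = range (\<lambda>a. Q a * \<delta>)
      in \<lparr>carrier = C,
          mult = (*),
          one = 1,
          src = Q,
          tgt = S,
          comult = (\<lambda>f. pure_tensor C C (\<lambda>f a. S a * f) (\<lambda>a f. Q a * f) (Q (\<epsilon> * f * \<mu>) * \<delta>) \<delta>),
          counit = (\<lambda>f. \<epsilon> * f * \<eta>)\<rparr>)"

definition smm_pairing :: "'a::monoid_mult \<Rightarrow> 'a \<Rightarrow> 'a \<Rightarrow> 'a \<Rightarrow> 'a" where
  "smm_pairing \<eta> \<epsilon> f g = \<epsilon> * f * g * \<eta>"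

end

theory Submission
  imports Defs
begin

text \<open>
  Every \<open>g \<in> G\<close> equals \<open>\<mu> T(g\<eta>)\<close> and every \<open>f \<in> F\<close> equals \<open>Q(\<epsilon>f) \<delta>\<close>, because \<open>\<mu>\<eta> = 1 = \<epsilon>\<delta>\<close>. So
  \<open>g \<mapsto> g\<eta>\<close> and \<open>f \<mapsto> \<epsilon>f\<close> are bijections onto \<open>A\<close>; in these coordinates the pairing is the
  multiplication of \<open>A\<close>, and since \<open>G\<close> is free on \<open>\<mu>\<close> as a right \<open>A\<close>-set, every element of \<open>G\<^sup>*\<close>
  is of the form \<open>\<langle>f, -\<rangle>\<close> for a unique \<open>f\<close>. The tensor squares are copies of \<open>A\<close> as well, via
  \<open>x \<otimes> y \<mapsto> Q(x\<eta>) y\<eta>\<close> for \<open>G\<close> and \<open>x \<otimes> y \<mapsto> \<epsilon>x T(\<epsilon>y)\<close> for \<open>F\<close>; the comultiplications become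
  \<open>g \<mapsto> \<delta>g\<eta>\<close> and \<open>f \<mapsto> \<epsilon>f\<mu>\<close>, so all bialgebroid axioms turn into identities in \<open>A\<close>. The
  multiplicativity of both comultiplications rests on \<open>Q(\<mu>) \<gamma> T(\<delta>) = \<delta>\<mu>\<close>.
\<close>

section \<open>Tensor products and their normal forms\<close>

lemma generated_equiv_sym:
  assumes "(p, q) \<in> generated_equiv X R"
  shows "(q, p) \<in> generated_equiv X R"
proof -
  have "sym ((R \<union> R\<inverse>)\<^sup>*)"
    by (intro sym_rtrancl sym_Un_converse)
  then show ?thesis
    using assms by (auto simp: generated_equiv_def dest: symD)
qed

lemma generated_equiv_trans:
  assumes "(p, q) \<in> generated_equiv X R" "(q, s) \<in> generated_equiv X R"
  shows "(p, s) \<in> generated_equiv X R"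
  using assms by (auto simp: generated_equiv_def)

lemma generated_equiv_step:
  assumes "(p, q) \<in> R" "p \<in> X" "q \<in> X"
  shows "(p, q) \<in> generated_equiv X R"
  using assms by (auto simp: generated_equiv_def)

text \<open>\<open>J\<close> is constant along generating pairs, which gives one inclusion.
  Conversely, two points with the same invariant are both connected to the one representative
  \<open>n (J p)\<close>.\<close>

lemma generated_equiv_normal_form:
  assumes step: "\<And>p q. (p, q) \<in> R \<Longrightarrow> J p = J q"
    and nf: "\<And>p. p \<in> X \<Longrightarrow> (p, n (J p)) \<in> generated_equiv X R"
  shows "generated_equiv X R = {(p, q). p \<in> X \<and> q \<in> X \<and> J p = J q}"
proof (intro equalityI subsetI)
  fix e assume "e \<in> generated_equiv X R"
  then obtain p q where e: "e = (p, q)" "p \<in> X" "q \<in> X" "(p, q) \<in> (R \<union> R\<inverse>)\<^sup>*"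
    by (auto simp: generated_equiv_def)
  from e(4) have "J p = J q"
    by induction (auto dest: step)
  with e show "e \<in> {(p, q). p \<in> X \<and> q \<in> X \<and> J p = J q}" by simp
next
  fix e assume "e \<in> {(p, q). p \<in> X \<and> q \<in> X \<and> J p = J q}"
  then obtain p q where e: "e = (p, q)" "p \<in> X" "q \<in> X" "J p = J q" by auto
  then show "e \<in> generated_equiv X R"
    using generated_equiv_trans[OF nf[OF e(2)] generated_equiv_sym] nf[OF e(3)] by simp
qed

text \<open>Variant of an equation that still rewrites after right-associating.\<close>

lemma mult_eq_left:
  fixes a b c :: "'a::semigroup_mult"
  shows "a * b = c \<Longrightarrow> a * (b * z) = c * z"
  by (simp add: mult.assoc[symmetric])

section \<open>Identities in a skew monoidal monoid\<close>

context skew_monoidal_monoid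
begin

abbreviation "\<mu> \<equiv> smm_mu Q \<gamma> \<epsilon>"
abbreviation "\<delta> \<equiv> smm_delta T \<gamma> \<eta>"
abbreviation "S \<equiv> smm_S T Q \<gamma> \<eta> \<epsilon>"
abbreviation "G \<equiv> smm_G T Q \<gamma> \<eta> \<epsilon>"
abbreviation "F \<equiv> smm_F T Q \<gamma> \<eta> \<epsilon>"

lemmas Q_T = T_Q_commute[symmetric]
lemmas Q_T_left = mult_eq_left[OF Q_T]
  and T_Q_left = mult_eq_left[OF T_Q_commute]

section \<open>Unit and naturality laws for \<open>\<mu>\<close> and \<open>\<delta>\<close>\<close>

lemma mu_T_eta: "\<mu> * T \<eta> = 1"
  by (simp add: smm_mu_def Qeps_gamma_Teta)

lemma Q_eps_delta: "Q \<epsilon> * \<delta> = 1"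
  using Qeps_gamma_Teta by (simp add: smm_delta_def mult.assoc)

lemma mu_eta: "\<mu> * \<eta> = 1"
  by (simp add: smm_mu_def mult.assoc gamma_eta) (metis Q_mult Q_one eps_eta)

lemma eps_delta: "\<epsilon> * \<delta> = 1"
  by (simp add: smm_delta_def mult.assoc[symmetric] eps_gamma) (metis T_mult T_one eps_eta)

lemma eps_Q: "\<epsilon> * Q a = a * \<epsilon>"
  by (simp add: eps_natural)

lemma eps_mu: "\<epsilon> * \<mu> = \<epsilon> * T \<epsilon>"
proof -
  have "\<epsilon> * \<mu> = \<epsilon> * (\<epsilon> * \<gamma>)"
    by (simp add: smm_mu_def mult.assoc[symmetric] eps_Q)
  then show ?thesis by (simp add: eps_gamma)
qed

lemma delta_eta: "\<delta> * \<eta> = Q \<eta> * \<eta>"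
proof -
  have "\<delta> * \<eta> = \<gamma> * (\<eta> * \<eta>)"
    by (simp add: smm_delta_def mult.assoc eta_natural)
  then show ?thesis by (simp add: mult.assoc[symmetric] gamma_eta)
qed

lemma mu_TT: "\<mu> * T (T a) = T a * \<mu>"
  by (simp add: smm_mu_def mult.assoc gamma_TT) (simp add: mult.assoc[symmetric] T_Q_commute)

lemma mu_Q: "\<mu> * Q a = Q a * \<mu>"
proof -
  have "\<mu> * Q a = Q (\<epsilon> * Q a) * \<gamma>"
    by (simp add: smm_mu_def mult.assoc gamma_Q Q_mult)
  then show ?thesis by (simp add: eps_Q Q_mult smm_mu_def mult.assoc)
qed

lemma delta_T: "\<delta> * T a = T a * \<delta>"
proof -
  have "\<delta> * T a = \<gamma> * T (\<eta> * a)"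
    by (simp add: smm_delta_def mult.assoc T_mult)
  also have "\<dots> = \<gamma> * T (T a) * T \<eta>"
    by (simp add: eta_natural T_mult mult.assoc)
  finally show ?thesis by (simp add: gamma_TT smm_delta_def mult.assoc)
qed

lemma delta_Q: "\<delta> * Q a = Q (Q a) * \<delta>"
proof -
  have "\<delta> * Q a = \<gamma> * Q a * T \<eta>"
    by (simp add: smm_delta_def mult.assoc T_Q_commute)
  then show ?thesis by (simp add: gamma_Q smm_delta_def mult.assoc)
qed

section \<open>Consequences of the pentagon\<close>

lemma mu_delta: "\<mu> * \<delta> = \<gamma>"
proof -
  have "\<mu> * \<delta> = Q \<epsilon> * (\<gamma> * \<gamma>) * T \<eta>"
    by (simp add: smm_mu_def smm_delta_def mult.assoc)
  \<comment> \<open>The pentagon, read from right to left, brings \<open>\<epsilon>\<close> and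
    \<open>\<eta>\<close> next to a \<open>\<gamma>\<close> each, so that both unit laws
    apply.\<close>
  also have "\<dots> = Q (\<epsilon> * \<gamma>) * \<gamma> * T (\<gamma> * \<eta>)"
    unfolding pentagon[symmetric] by (simp add: Q_mult T_mult mult.assoc)
  also have "\<dots> = Q (T \<epsilon>) * \<gamma> * T (Q \<eta>)"
    by (simp add: eps_gamma gamma_eta)
  also have "\<dots> = \<gamma> * T (Q (\<epsilon> * \<eta>))"
    by (simp add: gamma_TQ[symmetric] Q_mult T_mult mult.assoc)
  finally show ?thesis by (simp add: eps_eta Q_one T_one)
qed

text \<open>The pentagon combined with the law for \<open>\<epsilon>\<close> only. It closes
  \<open>G\<close> under products and gives coassociativity for \<open>F\<close>;
  \<open>delta_delta\<close> is the mirror image, with \<open>\<eta>\<close> for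
  \<open>\<epsilon>\<close> and the roles of \<open>G\<close> and \<open>F\<close>
  exchanged.\<close>

lemma mu_mu: "\<mu> * \<mu> = \<mu> * T \<mu>"
proof -
  have "\<mu> * \<mu> = Q \<epsilon> * \<mu> * \<gamma>"
    using mu_Q[of \<epsilon>] by (simp add: smm_mu_def mult.assoc[symmetric])
  also have "\<dots> = Q \<epsilon> * Q \<epsilon> * (\<gamma> * \<gamma>)"
    by (simp add: smm_mu_def mult.assoc)
  also have "\<dots> = Q \<epsilon> * Q (\<epsilon> * \<gamma>) * \<gamma> * T \<gamma>"
    unfolding pentagon[symmetric] by (simp add: Q_mult mult.assoc)
  also have "\<dots> = Q \<epsilon> * (\<gamma> * T (Q \<epsilon>)) * T \<gamma>"
    by (simp add: eps_gamma gamma_TQ mult.assoc)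
  finally show ?thesis by (simp add: smm_mu_def T_mult mult.assoc)
qed

lemma delta_delta: "\<delta> * \<delta> = Q \<delta> * \<delta>"
proof -
  have "\<delta> * \<delta> = \<gamma> * (T \<eta> * \<gamma>) * T \<eta>"
    by (simp add: smm_delta_def mult.assoc)
  also have "\<dots> = \<gamma> * \<gamma> * T (T \<eta>) * T \<eta>"
    by (simp add: mult.assoc flip: gamma_TT)
  also have "\<dots> = Q \<gamma> * \<gamma> * T (\<delta> * \<eta>)"
    unfolding pentagon[symmetric] by (simp add: smm_delta_def T_mult mult.assoc)
  also have "\<dots> = Q \<gamma> * (\<gamma> * T (Q \<eta>)) * T \<eta>"
    by (simp add: delta_eta T_mult mult.assoc)
  finally show ?thesis
    by (simp add: gamma_TQ smm_delta_def Q_mult mult.assoc)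
qed

text \<open>The pentagon is squeezed between \<open>Q (Q \<epsilon>)\<close> and
  \<open>T (T \<eta>)\<close>; naturality then pulls \<open>T \<eta>\<close> in between the two
  copies of \<open>\<gamma>\<close>, and \<open>Q \<epsilon>\<close> through
  \<open>\<delta>\<close>.\<close>

lemma Q_mu_gamma_T_delta: "Q \<mu> * \<gamma> * T \<delta> = \<delta> * \<mu>"
proof -
  have "Q \<mu> * \<gamma> * T \<delta> = Q (Q \<epsilon>) * (\<gamma> * \<gamma>) * T (T \<eta>)"
    unfolding pentagon[symmetric]
    by (simp add: smm_mu_def smm_delta_def T_mult Q_mult mult.assoc)
  also have "\<dots> = Q (Q \<epsilon>) * \<delta> * \<gamma>"
    by (simp add: smm_delta_def gamma_TT mult.assoc)
  also have "\<dots> = \<delta> * \<mu>"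
    by (simp add: delta_Q[symmetric] smm_mu_def mult.assoc)
  finally show ?thesis .
qed

lemmas mu_eta_left = mult_eq_left[OF mu_eta]
  and eps_delta_left = mult_eq_left[OF eps_delta]
  and Q_eps_delta_left = mult_eq_left[OF Q_eps_delta]
  and eps_Q_left = mult_eq_left[OF eps_Q]
  and mu_TT_left = mult_eq_left[OF mu_TT]
  and mu_Q_left = mult_eq_left[OF mu_Q]
  and delta_T_left = mult_eq_left[OF delta_T]
  and delta_Q_left = mult_eq_left[OF delta_Q]
  and mu_delta_left = mult_eq_left[OF mu_delta]
  and mu_mu_left = mult_eq_left[OF mu_mu]

section \<open>The target map \<open>S\<close>\<close>

lemma T_eta: "T a * \<eta> = \<eta> * a"
  by (simp add: eta_natural)

lemma S_eta: "S a * \<eta> = Q a * \<eta>"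
  by (simp add: smm_S_def mult.assoc T_eta mu_eta_left)

text \<open>The coordinates of tensors nest \<open>Q\<close>, and once \<open>Q_mult\<close> has
  split the products, \<open>T_eta\<close> and \<open>S_eta\<close> no longer match. Hence these
  versions under one or two layers of \<open>Q\<close>.\<close>

lemma Q_T_eta: "Q (T a) * Q \<eta> = Q \<eta> * Q a"
  by (simp add: Q_mult[symmetric] T_eta)

lemma QQ_T_eta: "Q (Q (T a)) * Q (Q \<eta>) = Q (Q \<eta>) * Q (Q a)"
  by (simp add: Q_mult[symmetric] T_eta)

lemma Q_S_eta: "Q (S a) * Q \<eta> = Q (Q a) * Q \<eta>"
  by (simp add: Q_mult[symmetric] S_eta)

lemmas Q_T_eta_left = mult_eq_left[OF Q_T_eta]
  and QQ_T_eta_left = mult_eq_left[OF QQ_T_eta]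
  and Q_S_eta_left = mult_eq_left[OF Q_S_eta]

text \<open>Behind \<open>\<epsilon>\<close> the target acts as \<open>T\<close>, just as by
  \<open>S_eta\<close> it acts as \<open>Q\<close> in front of \<open>\<eta>\<close>. These rules
  carry the target into the coordinates of \<open>F\<close> and of \<open>G\<close>.\<close>

lemma eps_S: "\<epsilon> * S a = \<epsilon> * T a"
proof -
  have "\<epsilon> * S a = \<epsilon> * T (\<epsilon> * Q a) * T \<eta>"
    by (simp add: smm_S_def mult.assoc[symmetric] eps_mu T_mult)
  also have "\<dots> = \<epsilon> * T a * T (\<epsilon> * \<eta>)"
    by (simp add: eps_Q T_mult mult.assoc)
  finally show ?thesis by (simp add: eps_eta T_one)
qed

text \<open>The definition of \<open>S\<close> exhibits its values as elements of \<open>G\<close>;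
  this form shows that they lie in \<open>F\<close> as well.\<close>

lemma S_delta_form: "S a = Q (\<epsilon> * T a) * \<delta>"
  by (simp add: smm_S_def smm_mu_def smm_delta_def T_mult Q_mult mult.assoc)
    (simp add: mult.assoc[symmetric] gamma_TQ)

lemmas S_eta_left = mult_eq_left[OF S_eta]
  and eps_S_left = mult_eq_left[OF eps_S]

lemma S_T: "S b * T a = T a * S b"
proof -
  have "S b * T a = \<mu> * T (Q b * (T a * \<eta>))"
    by (simp add: smm_S_def mult.assoc T_mult[symmetric] eta_natural)
  then show ?thesis
    by (simp add: Q_T_left T_mult mu_TT_left smm_S_def mult.assoc)
qed

lemma S_Q: "S b * Q a = Q a * S b"
  by (simp add: smm_S_def mult.assoc T_Q_commute mu_Q_left)

text \<open>This rule and \<open>mu_S\<close> are the source of the Takeuchi conditions for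
  \<open>G\<close> and \<open>F\<close> respectively: next to \<open>\<delta>\<close> or
  \<open>\<mu>\<close>, the target turns into the source acting on the other tensor factor.\<close>

lemma S_delta: "S a * \<delta> = Q (T a) * \<delta>"
  by (simp add: smm_S_def mult.assoc delta_T[symmetric] mu_delta_left)
    (simp add: smm_delta_def T_mult mult.assoc[symmetric] gamma_TQ)

lemma mu_S: "\<mu> * S a = \<mu> * T (Q a)"
  by (simp add: smm_S_def mu_mu_left mult.assoc T_mult[symmetric] mu_Q_left mu_eta)

lemmas S_Q_left = mult_eq_left[OF S_Q]
  and S_delta_left = mult_eq_left[OF S_delta]

section \<open>The right bialgebroid \<open>G\<close>\<close>

lemma carrier_G: "carrier G = range (\<lambda>a. \<mu> * T a)"
  and mult_G: "x \<otimes>\<^bsub>G\<^esub> y = x * y"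
  and one_G: "\<one>\<^bsub>G\<^esub> = 1"
  and src_G: "src G = T"
  and tgt_G: "tgt G = S"
  and counit_G: "counit G g = \<epsilon> * g * \<eta>"
  by (simp_all add: smm_G_def Let_def)

lemma rb_ract_G: "rb_ract G g a = g * T a"
  and rb_lact_G: "rb_lact G a g = g * S a"
  by (simp_all add: rb_ract_def rb_lact_def mult_G src_G tgt_G)

lemma comult_G_tensor: "comult G g = rb_tensor G \<mu> (\<mu> * T (\<delta> * g * \<eta>))"
proof -
  have "rb_ract G = (\<lambda>g a. g * T a)" "rb_lact G = (\<lambda>a g. g * S a)"
    by (simp_all add: fun_eq_iff rb_ract_G rb_lact_G)
  then show ?thesis
    by (simp only: carrier_G) (simp add: smm_G_def Let_def)
qed

section \<open>Elements of \<open>G\<close> and their coordinates\<close>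

lemma mu_T_in_G: "\<mu> * T a \<in> carrier G"
  by (simp add: carrier_G)

lemma mu_in_G: "\<mu> \<in> carrier G"
  using mu_T_in_G[of 1] by (simp add: T_one)

lemma G_normal: "g \<in> carrier G \<Longrightarrow> g = \<mu> * T (g * \<eta>)"
  by (auto simp: carrier_G mult.assoc T_eta mu_eta_left)

lemma G_eqI: "x \<in> carrier G \<Longrightarrow> y \<in> carrier G \<Longrightarrow> x * \<eta> = y * \<eta> \<Longrightarrow> x = y"
  using G_normal by metis

text \<open>Both \<open>\<mu>\<close> and \<open>T(A)\<close> commute with \<open>Q(A)\<close>. This
  is how the \<open>Q\<close>-part of a coordinate is moved to the front.\<close>

lemma G_Q: "g \<in> carrier G \<Longrightarrow> g * Q a = Q a * g"
  by (auto simp: carrier_G mult.assoc T_Q_commute mu_Q_left)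

lemma Q_G_Q: "g \<in> carrier G \<Longrightarrow> Q g * Q (Q a) = Q (Q a) * Q g"
  by (simp add: Q_mult[symmetric] G_Q)

lemmas G_Q_left = mult_eq_left[OF G_Q]
  and Q_G_Q_left = mult_eq_left[OF Q_G_Q]

lemma G_mult_closed: "x \<in> carrier G \<Longrightarrow> y \<in> carrier G \<Longrightarrow> x * y \<in> carrier G"
proof -
  \<comment> \<open>The second \<open>\<mu>\<close> moves left past \<open>T a\<close> at the cost
    of another \<open>T\<close>, and then \<open>mu_mu\<close> applies.\<close>
  have "\<mu> * T a * (\<mu> * T b) = \<mu> * T (\<mu> * (T a * b))" for a b
    by (simp add: mult.assoc T_mult mult_eq_left[OF mu_TT[symmetric]] mu_mu_left)
  then show "x \<in> carrier G \<Longrightarrow> y \<in> carrier G \<Longrightarrow> x * y \<in> carrier G"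
    by (auto simp: carrier_G)
qed

lemma T_in_G: "T a \<in> carrier G"
proof -
  have "T a = \<mu> * T (T a * \<eta>)"
    by (simp add: T_mult mu_TT_left mult.assoc mu_T_eta)
  then show ?thesis by (metis mu_T_in_G)
qed

lemma one_in_G: "1 \<in> carrier G"
  using T_in_G[of 1] by (simp add: T_one)

lemma S_in_G: "S a \<in> carrier G"
  by (simp add: smm_S_def mu_T_in_G)

lemma S_one: "S 1 = 1"
  by (simp add: smm_S_def Q_one mu_T_eta)

lemma S_mult: "S (a * b) = S b * S a"
proof (rule G_eqI)
  \<comment> \<open>Only the last \<open>S\<close> meets \<open>\<eta>\<close> and becomes
    \<open>Q a\<close>; it moves to the front past \<open>S b\<close>, which then becomes
    \<open>Q b\<close>. This reverses the order.\<close>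
  show "S (a * b) * \<eta> = S b * S a * \<eta>"
    by (simp add: mult.assoc S_eta S_Q_left Q_mult)
qed (auto intro: S_in_G G_mult_closed)


section \<open>Tensor squares and cubes of \<open>G\<close> in coordinates\<close>

lemma tensor_rel_G:
  "tensor_rel (carrier G) (carrier G) (rb_ract G) (rb_lact G) =
     {((x, y), (x', y')). x \<in> carrier G \<and> y \<in> carrier G \<and> x' \<in> carrier G \<and> y' \<in> carrier G \<and>
        Q (x * \<eta>) * y * \<eta> = Q (x' * \<eta>) * y' * \<eta>}"
proof -
  let ?R = "{((rb_ract G x a, y), (x, rb_lact G a y)) | x y a. x \<in> carrier G \<and> y \<in> carrier G}"
  let ?J = "\<lambda>(x, y). Q (x * \<eta>) * y * \<eta>"
  have "generated_equiv (carrier G \<times> carrier G) ?R =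
      {(p, q). p \<in> carrier G \<times> carrier G \<and> q \<in> carrier G \<times> carrier G \<and> ?J p = ?J q}"
  \<comment> \<open>Since \<open>x\<close> is \<open>\<mu>\<close> acted on by
    \<open>x * \<eta>\<close>, that element can be pushed across the tensor sign. What remains on
    the left is \<open>\<mu>\<close>, on the right an element of \<open>G\<close> determined by its
    coordinate.\<close>
  proof (rule generated_equiv_normal_form[where n = "\<lambda>b. (\<mu>, \<mu> * T b)"])
    show "?J p = ?J q" if "(p, q) \<in> ?R" for p q
      using that
      by (auto simp: rb_ract_G rb_lact_G mult.assoc S_eta Q_mult G_Q_left Q_T_eta_left)
  next
    fix p assume "p \<in> carrier G \<times> carrier G"
    then obtain x y where p: "p = (x, y)" "x \<in> carrier G" "y \<in> carrier G" by auto
    have x: "rb_ract G \<mu> (x * \<eta>) = x"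
      using G_normal[OF p(2)] by (simp add: rb_ract_G)
    have "rb_lact G (x * \<eta>) y = \<mu> * T (Q (x * \<eta>) * y * \<eta>)"
    proof (rule G_eqI)
      show "rb_lact G (x * \<eta>) y * \<eta> = \<mu> * T (Q (x * \<eta>) * y * \<eta>) * \<eta>"
        using p by (simp add: rb_lact_G mult.assoc S_eta G_Q_left T_eta mu_eta_left)
    qed (use p in \<open>auto simp: rb_lact_G intro: G_mult_closed S_in_G mu_T_in_G\<close>)
    moreover have "((rb_ract G \<mu> (x * \<eta>), y), (\<mu>, rb_lact G (x * \<eta>) y)) \<in> ?R"
      using p mu_in_G by blast
    ultimately have "(p, (\<mu>, \<mu> * T (?J p))) \<in> ?R"
      by (simp only: x p(1) case_prod_conv)
    then show "(p, (\<mu>, \<mu> * T (?J p))) \<in> generated_equiv (carrier G \<times> carrier G) ?R"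
      by (rule generated_equiv_step) (use p in \<open>auto simp: mu_in_G mu_T_in_G\<close>)
  qed
  then show ?thesis
    unfolding tensor_rel_def by auto
qed

lemma rb_tensor_G:
  assumes "x \<in> carrier G" "y \<in> carrier G"
  shows "rb_tensor G x y = {(x', y'). x' \<in> carrier G \<and> y' \<in> carrier G \<and>
    Q (x' * \<eta>) * y' * \<eta> = Q (x * \<eta>) * y * \<eta>}"
  using assms by (auto simp: pure_tensor_def tensor_rel_G)

lemma comult_G:
  "comult G g = {(x, y). x \<in> carrier G \<and> y \<in> carrier G \<and> Q (x * \<eta>) * y * \<eta> = \<delta> * g * \<eta>}"
  unfolding comult_G_tensor
  by (simp add: rb_tensor_G mu_in_G mu_T_in_G mu_eta Q_one mult.assoc T_eta mu_eta_left)

lemma rb_tensor3_G: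
  assumes "x \<in> carrier G" "y \<in> carrier G" "z \<in> carrier G"
  shows "rb_tensor3 G x y z = {(x', y', z'). x' \<in> carrier G \<and> y' \<in> carrier G \<and> z' \<in> carrier G \<and>
    Q (Q (x' * \<eta>) * y' * \<eta>) * z' * \<eta> = Q (Q (x * \<eta>) * y * \<eta>) * z * \<eta>}"
proof -
  let ?X = "carrier G \<times> carrier G \<times> carrier G"
  let ?R = "{((rb_ract G x a, y, z), (x, rb_lact G a y, z)) | x y z a.
      x \<in> carrier G \<and> y \<in> carrier G \<and> z \<in> carrier G} \<union>
    {((x, rb_ract G y a, z), (x, y, rb_lact G a z)) | x y z a.
      x \<in> carrier G \<and> y \<in> carrier G \<and> z \<in> carrier G}"
  let ?J = "\<lambda>(x, y, z). Q (Q (x * \<eta>) * y * \<eta>) * z * \<eta>"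
  \<comment> \<open>Rewritten as a right action on \<open>\<mu>\<close>, the left action can be
    pushed on across the next tensor sign. The normal form is reached in two pushes, from the first
    factor into the second and from there into the third.\<close>
  have lact: "rb_lact G (x * \<eta>) y = rb_ract G \<mu> (Q (x * \<eta>) * y * \<eta>)"
    if "x \<in> carrier G" "y \<in> carrier G" for x y
  proof (rule G_eqI)
    show "rb_lact G (x * \<eta>) y * \<eta> = rb_ract G \<mu> (Q (x * \<eta>) * y * \<eta>) * \<eta>"
      using that by (simp add: rb_lact_G rb_ract_G mult.assoc S_eta G_Q_left T_eta mu_eta_left)
  qed (use that in \<open>auto simp: rb_lact_G rb_ract_G intro: G_mult_closed S_in_G mu_T_in_G\<close>)
  have "generated_equiv ?X ?R = {(p, q). p \<in> ?X \<and> q \<in> ?X \<and> ?J p = ?J q}"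
  proof (rule generated_equiv_normal_form[where n = "\<lambda>b. (\<mu>, \<mu>, \<mu> * T b)"])
    show "?J p = ?J q" if "(p, q) \<in> ?R" for p q
      using that
      by (auto simp: rb_ract_G rb_lact_G mult.assoc S_eta Q_mult G_Q_left
          Q_T_eta_left QQ_T_eta_left Q_S_eta_left Q_G_Q_left)
  next
    fix p assume "p \<in> ?X"
    then obtain x y z where p: "p = (x, y, z)" "x \<in> carrier G" "y \<in> carrier G" "z \<in> carrier G"
      by auto
    define b where "b = Q (x * \<eta>) * y * \<eta>"
    have x: "rb_ract G \<mu> (x * \<eta>) = x"
      using G_normal[OF p(2)] by (simp add: rb_ract_G)
    have y: "rb_lact G (x * \<eta>) y = rb_ract G \<mu> b"
      using lact p by (simp add: b_def)
    have b: "rb_ract G \<mu> b \<in> carrier G" "rb_ract G \<mu> b * \<eta> = b"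
      by (simp_all add: rb_ract_G mu_T_in_G mult.assoc T_eta mu_eta_left)
    have z: "rb_lact G b z = \<mu> * T (?J p)"
      using lact[OF b(1) p(4)] p by (simp add: b(2)) (simp add: rb_ract_G b_def)
    have "((rb_ract G \<mu> (x * \<eta>), y, z), (\<mu>, rb_lact G (x * \<eta>) y, z)) \<in> ?R"
      using p mu_in_G by blast
    then have "(p, (\<mu>, rb_ract G \<mu> b, z)) \<in> ?R"
      by (simp only: x y p(1))
    then have 1: "(p, (\<mu>, rb_ract G \<mu> b, z)) \<in> generated_equiv ?X ?R"
      by (rule generated_equiv_step) (use p b in \<open>auto simp: mu_in_G\<close>)
    have "((\<mu>, rb_ract G \<mu> b, z), (\<mu>, \<mu>, \<mu> * T (?J p))) \<in> ?R"
      unfolding z[symmetric] using p mu_in_G by (intro UnI2) auto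
    then have 2: "((\<mu>, rb_ract G \<mu> b, z), (\<mu>, \<mu>, \<mu> * T (?J p))) \<in> generated_equiv ?X ?R"
      by (rule generated_equiv_step) (use p b in \<open>auto simp: mu_in_G mu_T_in_G\<close>)
    show "(p, (\<mu>, \<mu>, \<mu> * T (?J p))) \<in> generated_equiv ?X ?R"
      by (rule generated_equiv_trans[OF 1 2])
  qed
  then show ?thesis
    unfolding pure_tensor3_def using assms by auto
qed

section \<open>The bialgebroid axioms of \<open>G\<close>\<close>

lemma right_bialgebroid_G: "right_bialgebroid G"
proof (unfold_locales, unfold carrier_G[symmetric] mult_G one_G src_G tgt_G)
  fix g x y a b assume g: "g \<in> carrier G" and "(x, y) \<in> comult G g"
  then have xy: "x \<in> carrier G" "y \<in> carrier G" "Q (x * \<eta>) * y * \<eta> = \<delta> * g * \<eta>"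
    by (auto simp: comult_G)
  have xy': "Q x * (Q \<eta> * (y * \<eta>)) = \<delta> * (g * \<eta>)"
    using xy(3) by (simp add: Q_mult mult.assoc)
  have gS: "g * S c * T d \<in> carrier G" if "g \<in> carrier G" for g c d
    using that by (auto intro!: G_mult_closed S_in_G T_in_G)
  show "comult G (rb_ract G (rb_lact G a g) b) = rb_tensor G (rb_lact G a x) (rb_ract G y b)"
  proof -
    have "Q (x * S a * \<eta>) * (y * T b) * \<eta> = Q (Q a) * (Q (x * \<eta>) * y * \<eta>) * b"
      using xy(1,2) by (simp add: mult.assoc S_eta G_Q_left T_eta Q_mult)
    also have "\<dots> = \<delta> * (g * S a * T b) * \<eta>"
      unfolding xy(3) using g by (simp add: mult.assoc S_eta_left T_eta delta_Q_left G_Q_left)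
    finally show ?thesis
      using xy(1,2) gS[of x a 1] gS[of y 1 b]
      by (simp add: rb_ract_G rb_lact_G comult_G rb_tensor_G S_one T_one)
  qed
  show "rb_lact G (counit G x) y = g"
  proof (rule G_eqI)
    show "rb_lact G (counit G x) y * \<eta> = g * \<eta>"
      using xy by (simp add: rb_lact_G counit_G mult.assoc S_eta G_Q_left Q_mult xy' Q_eps_delta_left)
  qed (use g xy in \<open>auto simp: rb_lact_G intro!: G_mult_closed S_in_G\<close>)
  show "rb_ract G x (counit G y) = g"
  proof (rule G_eqI)
    have "x * T (\<epsilon> * y * \<eta>) * \<eta> = x * \<eta> * \<epsilon> * y * \<eta>"
      by (simp add: mult.assoc T_eta)
    also have "\<dots> = \<epsilon> * (Q (x * \<eta>) * y * \<eta>)"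
      by (simp add: mult.assoc[symmetric] eps_Q)
    finally show "rb_ract G x (counit G y) * \<eta> = g * \<eta>"
      by (simp add: rb_ract_G counit_G xy(3)) (simp add: mult.assoc eps_delta_left)
  qed (use g xy in \<open>auto simp: rb_ract_G intro!: G_mult_closed T_in_G\<close>)
  show "rb_tensor G (T a * x) y = rb_tensor G x (S a * y)"
  proof -
    have "Q x * (Q \<eta> * (S a * (y * \<eta>))) = S a * (Q x * (Q \<eta> * (y * \<eta>)))"
      by (simp add: S_Q_left mult.assoc)
    then have "Q (T a * x * \<eta>) * y * \<eta> = Q (x * \<eta>) * (S a * y) * \<eta>"
      by (simp add: Q_mult mult.assoc xy' S_delta_left)
    then show ?thesis
      using xy by (simp add: rb_tensor_G G_mult_closed T_in_G S_in_G)
  qed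
  fix g' x' y' assume g': "g' \<in> carrier G" and "(x', y') \<in> comult G g'"
  then have xy2: "x' \<in> carrier G" "y' \<in> carrier G" "Q (x' * \<eta>) * y' * \<eta> = \<delta> * g' * \<eta>"
    by (auto simp: comult_G)
  show "comult G (g * g') = rb_tensor G (x * x') (y * y')"
  proof -
    define u v w where "u = x * \<eta>" and "v = y * \<eta>" and "w = g * \<eta>"
    have x: "x = \<mu> * T u" and y: "y = \<mu> * T v" and gw: "g = \<mu> * T w"
      using G_normal xy g unfolding u_def v_def w_def by auto
    have uv: "Q u * v = \<delta> * w"
      using xy(3) by (simp add: u_def v_def w_def mult.assoc)
    \<comment> \<open>The coordinate equation amounts to
      \<open>Q x * y * \<delta> * \<eta> = \<delta> * g * \<eta>\<close>. The product needs it with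
      \<open>\<eta>\<close> cancelled, which \<open>Q_mu_gamma_T_delta\<close> makes
      possible.\<close>
    have "Q x * y * \<delta> = Q \<mu> * (Q (T u) * \<mu> * \<delta>) * T v"
      by (simp add: x y Q_mult mult.assoc delta_T)
    also have "\<dots> = Q \<mu> * \<gamma> * T (Q u * v)"
      by (simp add: mult.assoc mu_delta T_mult) (simp add: mult.assoc[symmetric] gamma_TQ)
    also have "\<dots> = \<delta> * g"
      by (simp add: uv T_mult gw mult.assoc[symmetric] Q_mu_gamma_T_delta)
    finally have *: "Q x * y * \<delta> = \<delta> * g" .
    have "Q (x * x' * \<eta>) * (y * y') * \<eta> = Q x * y * (Q (x' * \<eta>) * y' * \<eta>)"
      using xy(2) by (simp add: Q_mult mult.assoc G_Q_left)
    also have "\<dots> = Q x * y * \<delta> * (g' * \<eta>)"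
      unfolding xy2(3) by (simp add: mult.assoc)
    also have "\<dots> = \<delta> * (g * g') * \<eta>"
      unfolding * by (simp add: mult.assoc)
    finally show ?thesis
      using xy xy2 by (simp add: comult_G rb_tensor_G G_mult_closed)
  qed
next
  fix g x y x1 x2 u v v1 v2
  assume "g \<in> carrier G" "(x, y) \<in> comult G g" "(x1, x2) \<in> comult G x"
    "(u, v) \<in> comult G g" "(v1, v2) \<in> comult G v"
  then have c: "x \<in> carrier G" "y \<in> carrier G" "x1 \<in> carrier G" "x2 \<in> carrier G"
      "u \<in> carrier G" "v \<in> carrier G" "v1 \<in> carrier G" "v2 \<in> carrier G"
    and e: "Q (x * \<eta>) * y * \<eta> = \<delta> * g * \<eta>" "Q (x1 * \<eta>) * x2 * \<eta> = \<delta> * x * \<eta>"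
      "Q (u * \<eta>) * v * \<eta> = \<delta> * g * \<eta>" "Q (v1 * \<eta>) * v2 * \<eta> = \<delta> * v * \<eta>"
    by (auto simp: comult_G)
  \<comment> \<open>Both sides have coordinate \<open>\<delta> * \<delta> * g * \<eta>\<close>;
    \<open>delta_delta\<close> mediates between the two ways of iterating the
    comultiplication.\<close>
  have "Q (Q (x1 * \<eta>) * x2 * \<eta>) * y * \<eta> = Q \<delta> * (Q (x * \<eta>) * y * \<eta>)"
    by (simp add: e(2)) (simp add: Q_mult mult.assoc)
  also have "\<dots> = \<delta> * \<delta> * g * \<eta>"
    by (simp add: e(1) delta_delta) (simp add: mult.assoc)
  also have "\<dots> = \<delta> * (Q (u * \<eta>) * v * \<eta>)"
    by (simp add: e(3)) (simp add: mult.assoc)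
  also have "\<dots> = Q (Q (u * \<eta>)) * (Q (v1 * \<eta>) * v2 * \<eta>)"
    by (simp add: e(4)) (simp add: delta_Q_left mult.assoc)
  also have "\<dots> = Q (Q (u * \<eta>) * v1 * \<eta>) * v2 * \<eta>"
    by (simp add: Q_mult mult.assoc)
  finally show "rb_tensor3 G x1 x2 y = rb_tensor3 G u v1 v2"
    using c by (simp add: rb_tensor3_G)
next
  fix g a b assume g: "g \<in> carrier G"
  show "counit G (rb_ract G (rb_lact G a g) b) = a * counit G g * b"
    using g by (simp add: counit_G rb_ract_G rb_lact_G mult.assoc T_eta S_eta_left G_Q_left eps_Q_left)
  show "comult G g \<in> tensor_prod (carrier G) (carrier G) (rb_ract G) (rb_lact G)"
    unfolding comult_G_tensor pure_tensor_def tensor_prod_def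
    by (intro quotientI) (simp add: mu_in_G mu_T_in_G)
next
  fix g g' assume g: "g \<in> carrier G" "g' \<in> carrier G"
  \<comment> \<open>By \<open>eps_mu\<close> and the normal form of \<open>g\<close>, replacing
    \<open>g\<close> by the source of its counit is invisible behind \<open>\<epsilon>\<close>. For
    the target, \<open>eps_S\<close> reduces to this case.\<close>
  have "\<epsilon> * T (\<epsilon> * g * \<eta>) = \<epsilon> * g"
    using G_normal[OF g(1)] by (metis T_mult eps_mu mult.assoc)
  then have *: "\<epsilon> * (T (\<epsilon> * g * \<eta>) * z) = \<epsilon> * (g * z)" for z
    by (simp add: mult.assoc[symmetric])
  show "counit G (g * g') = counit G (T (counit G g) * g')"
    using *[of "g' * \<eta>"] by (simp add: counit_G mult.assoc)
  show "counit G (g * g') = counit G (S (counit G g) * g')"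
    using *[of "g' * \<eta>"] by (simp add: counit_G mult.assoc eps_S_left)
qed (auto simp: G_mult_closed one_in_G T_in_G S_in_G T_one T_mult S_one S_mult mult.assoc S_T
    counit_G eps_eta comult_G rb_tensor_G Q_one delta_eta)


section \<open>The left bialgebroid \<open>F\<close> and its models\<close>

lemma carrier_F: "carrier F = range (\<lambda>a. Q a * \<delta>)"
  and mult_F: "x \<otimes>\<^bsub>F\<^esub> y = x * y"
  and one_F: "\<one>\<^bsub>F\<^esub> = 1"
  and src_F: "src F = Q"
  and tgt_F: "tgt F = S"
  and counit_F: "counit F f = \<epsilon> * f * \<eta>"
  by (simp_all add: smm_F_def Let_def)

lemma lb_ract_F: "lb_ract F f a = S a * f"
  and lb_lact_F: "lb_lact F a f = Q a * f"
  by (simp_all add: lb_ract_def lb_lact_def mult_F src_F tgt_F)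

lemma comult_F_tensor: "comult F f = lb_tensor F (Q (\<epsilon> * f * \<mu>) * \<delta>) \<delta>"
proof -
  have "lb_ract F = (\<lambda>f a. S a * f)" "lb_lact F = (\<lambda>a f. Q a * f)"
    by (simp_all add: fun_eq_iff lb_ract_F lb_lact_F)
  then show ?thesis
    by (simp only: carrier_F) (simp add: smm_F_def Let_def)
qed

section \<open>Elements of \<open>F\<close> and their coordinates\<close>

lemma Q_delta_in_F: "Q a * \<delta> \<in> carrier F"
  by (simp add: carrier_F)

lemma delta_in_F: "\<delta> \<in> carrier F"
  using Q_delta_in_F[of 1] by (simp add: Q_one)

lemma eps_Q_delta: "\<epsilon> * (Q a * \<delta>) = a"
  by (simp add: eps_Q_left eps_delta mult.assoc)

lemma F_normal: "f \<in> carrier F \<Longrightarrow> f = Q (\<epsilon> * f) * \<delta>"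
  by (auto simp: carrier_F eps_Q_delta)

lemma F_eqI: "x \<in> carrier F \<Longrightarrow> y \<in> carrier F \<Longrightarrow> \<epsilon> * x = \<epsilon> * y \<Longrightarrow> x = y"
  using F_normal by metis

lemma F_T: "f \<in> carrier F \<Longrightarrow> f * T a = T a * f"
  by (auto simp: carrier_F mult.assoc delta_T Q_T_left)

lemmas F_T_left = mult_eq_left[OF F_T]
  and T_F_left = mult_eq_left[OF F_T[symmetric]]

lemma F_mult_closed: "x \<in> carrier F \<Longrightarrow> y \<in> carrier F \<Longrightarrow> x * y \<in> carrier F"
proof -
  have "Q a * \<delta> * (Q b * \<delta>) = Q (a * Q b * \<delta>) * \<delta>" for a b
    by (simp add: mult.assoc delta_Q_left delta_delta Q_mult)
  then show "x \<in> carrier F \<Longrightarrow> y \<in> carrier F \<Longrightarrow> x * y \<in> carrier F"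
    by (auto simp: carrier_F)
qed

lemma Q_in_F: "Q a \<in> carrier F"
  using Q_delta_in_F[of "a * \<epsilon>"] by (simp add: Q_mult mult.assoc Q_eps_delta)

lemma one_in_F: "1 \<in> carrier F"
  using Q_in_F[of 1] by (simp add: Q_one)

lemma S_in_F: "S a \<in> carrier F"
  unfolding S_delta_form by (rule Q_delta_in_F)

text \<open>Because of \<open>delta_eta\<close>, in front of \<open>\<eta>\<close> an element may be
  replaced by the source of its counit. Both product axioms of the counit of \<open>F\<close> follow
  from this.\<close>

lemma F_eta: "f \<in> carrier F \<Longrightarrow> f * \<eta> = Q (\<epsilon> * f * \<eta>) * \<eta>"
  by (auto simp: carrier_F eps_Q_delta) (simp add: Q_mult mult.assoc delta_eta)

end

text \<open>Instantiated with \<open>B = F\<close> and with \<open>B = G\<^sup>*\<close>, so that the axioms are checked only once.\<close>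

locale F_model = skew_monoidal_monoid T Q \<gamma> \<eta> \<epsilon>
  for T Q :: "'a::monoid_mult \<Rightarrow> 'a" and \<gamma> \<eta> \<epsilon> +
  fixes B :: "('a, 'b) bialgebroid" and r :: "'b \<Rightarrow> 'a"
  assumes bij: "bij_betw r (carrier B) (carrier F)"
    and mult_closed: "x \<in> carrier B \<Longrightarrow> y \<in> carrier B \<Longrightarrow> x \<otimes>\<^bsub>B\<^esub> y \<in> carrier B"
    and r_mult: "x \<in> carrier B \<Longrightarrow> y \<in> carrier B \<Longrightarrow> r (x \<otimes>\<^bsub>B\<^esub> y) = r x * r y"
    and one_closed: "\<one>\<^bsub>B\<^esub> \<in> carrier B"
    and r_one: "r \<one>\<^bsub>B\<^esub> = 1"
    and src_closed: "src B a \<in> carrier B"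
    and r_src: "r (src B a) = Q a"
    and tgt_closed: "tgt B a \<in> carrier B"
    and r_tgt: "r (tgt B a) = S a"
begin

lemma r_in_F: "x \<in> carrier B \<Longrightarrow> r x \<in> carrier F"
  using bij by (auto simp: bij_betw_def)

lemma r_eqI: "x \<in> carrier B \<Longrightarrow> y \<in> carrier B \<Longrightarrow> \<epsilon> * r x = \<epsilon> * r y \<Longrightarrow> x = y"
  using bij F_eqI[OF r_in_F r_in_F] by (auto simp: bij_betw_def dest: inj_onD)

lemma lact_closed: "x \<in> carrier B \<Longrightarrow> lb_lact B a x \<in> carrier B"
  and ract_closed: "x \<in> carrier B \<Longrightarrow> lb_ract B x a \<in> carrier B"
  and r_lact: "x \<in> carrier B \<Longrightarrow> r (lb_lact B a x) = Q a * r x"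
  and r_ract: "x \<in> carrier B \<Longrightarrow> r (lb_ract B x a) = S a * r x"
  by (simp_all add: lb_lact_def lb_ract_def mult_closed src_closed tgt_closed r_mult r_src r_tgt)

text \<open>The element of coordinate \<open>a\<close>. In particular \<open>of_coord 1\<close>
  corresponds to \<open>\<delta>\<close> and freely generates the left \<open>A\<close>-set.\<close>

definition of_coord :: "'a \<Rightarrow> 'b" where
  "of_coord a = inv_into (carrier B) r (Q a * \<delta>)"

lemma of_coord_closed: "of_coord a \<in> carrier B"
  and r_of_coord: "r (of_coord a) = Q a * \<delta>"
proof -
  have "Q a * \<delta> \<in> r ` carrier B"
    using bij Q_delta_in_F by (auto simp: bij_betw_def)
  then show "of_coord a \<in> carrier B" "r (of_coord a) = Q a * \<delta>"
    by (auto simp: of_coord_def inv_into_into f_inv_into_f)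
qed

lemma lact_of_coord: "x \<in> carrier B \<Longrightarrow> lb_lact B (\<epsilon> * r x) (of_coord 1) = x"
  by (rule r_eqI)
    (use F_normal[OF r_in_F] in \<open>simp_all add: lact_closed of_coord_closed r_lact r_of_coord Q_one\<close>)

lemma ract_of_coord:
  assumes "x \<in> carrier B" "y \<in> carrier B"
  shows "lb_ract B x (\<epsilon> * r y) = of_coord (\<epsilon> * r x * T (\<epsilon> * r y))"
proof (rule r_eqI)
  show "\<epsilon> * r (lb_ract B x (\<epsilon> * r y)) = \<epsilon> * r (of_coord (\<epsilon> * r x * T (\<epsilon> * r y)))"
    using F_T[OF r_in_F[OF assms(1)]] assms
    by (simp add: r_ract r_of_coord eps_Q_delta eps_S_left mult.assoc)
qed (simp_all add: assms ract_closed of_coord_closed)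

section \<open>Tensor squares and cubes of a model of \<open>F\<close>\<close>

lemma tensor_rel_B:
  "tensor_rel (carrier B) (carrier B) (lb_ract B) (lb_lact B) =
     {((x, y), (x', y')). x \<in> carrier B \<and> y \<in> carrier B \<and> x' \<in> carrier B \<and> y' \<in> carrier B \<and>
        \<epsilon> * r x * T (\<epsilon> * r y) = \<epsilon> * r x' * T (\<epsilon> * r y')}"
proof -
  let ?R = "{((lb_ract B x a, y), (x, lb_lact B a y)) | x y a. x \<in> carrier B \<and> y \<in> carrier B}"
  let ?J = "\<lambda>(x, y). \<epsilon> * r x * T (\<epsilon> * r y)"
  have "generated_equiv (carrier B \<times> carrier B) ?R =
      {(p, q). p \<in> carrier B \<times> carrier B \<and> q \<in> carrier B \<times> carrier B \<and> ?J p = ?J q}"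
  \<comment> \<open>In contrast to \<open>G\<close>, the second factor is written as a multiple of
    the generator, and its coordinate moves left. The generating pair thus leads from the normal
    form to \<open>p\<close> and has to be reversed.\<close>
  proof (rule generated_equiv_normal_form[where n = "\<lambda>b. (of_coord b, of_coord 1)"])
    show "?J p = ?J q" if "(p, q) \<in> ?R" for p q
      using that
      by (auto simp: r_lact r_ract mult.assoc eps_S_left eps_Q_left T_F_left r_in_F
          T_mult[symmetric])
  next
    fix p assume "p \<in> carrier B \<times> carrier B"
    then obtain x y where p: "p = (x, y)" "x \<in> carrier B" "y \<in> carrier B" by auto
    have "((lb_ract B x (\<epsilon> * r y), of_coord 1), (x, lb_lact B (\<epsilon> * r y) (of_coord 1))) \<in> ?R"
      using p of_coord_closed by blast
    then have "((of_coord (?J p), of_coord 1), p) \<in> ?R"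
      by (simp only: ract_of_coord[OF p(2,3)] lact_of_coord[OF p(3)] p(1) case_prod_conv)
    then have "((of_coord (?J p), of_coord 1), p) \<in> generated_equiv (carrier B \<times> carrier B) ?R"
      by (rule generated_equiv_step) (use p in \<open>auto simp: of_coord_closed\<close>)
    then show "(p, (of_coord (?J p), of_coord 1)) \<in> generated_equiv (carrier B \<times> carrier B) ?R"
      by (rule generated_equiv_sym)
  qed
  then show ?thesis
    unfolding tensor_rel_def by auto
qed

lemma lb_tensor_B:
  assumes "x \<in> carrier B" "y \<in> carrier B"
  shows "lb_tensor B x y = {(x', y'). x' \<in> carrier B \<and> y' \<in> carrier B \<and>
    \<epsilon> * r x' * T (\<epsilon> * r y') = \<epsilon> * r x * T (\<epsilon> * r y)}"
  using assms by (auto simp: pure_tensor_def tensor_rel_B)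

lemma tensor_prod_B:
  assumes "X \<in> tensor_prod (carrier B) (carrier B) (lb_ract B) (lb_lact B)"
  obtains x y where "x \<in> carrier B" "y \<in> carrier B" "X = lb_tensor B x y"
  using assms unfolding tensor_prod_def pure_tensor_def by (auto elim!: quotientE)

lemma lb_tensor3_B:
  assumes "x \<in> carrier B" "y \<in> carrier B" "z \<in> carrier B"
  shows "lb_tensor3 B x y z = {(x', y', z'). x' \<in> carrier B \<and> y' \<in> carrier B \<and> z' \<in> carrier B \<and>
    \<epsilon> * r x' * T (\<epsilon> * r y' * T (\<epsilon> * r z')) = \<epsilon> * r x * T (\<epsilon> * r y * T (\<epsilon> * r z))}"
proof -
  let ?X = "carrier B \<times> carrier B \<times> carrier B"
  let ?R = "{((lb_ract B x a, y, z), (x, lb_lact B a y, z)) | x y z a.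
      x \<in> carrier B \<and> y \<in> carrier B \<and> z \<in> carrier B} \<union>
    {((x, lb_ract B y a, z), (x, y, lb_lact B a z)) | x y z a.
      x \<in> carrier B \<and> y \<in> carrier B \<and> z \<in> carrier B}"
  let ?J = "\<lambda>(x, y, z). \<epsilon> * r x * T (\<epsilon> * r y * T (\<epsilon> * r z))"
  have "generated_equiv ?X ?R = {(p, q). p \<in> ?X \<and> q \<in> ?X \<and> ?J p = ?J q}"
  proof (rule generated_equiv_normal_form[where n = "\<lambda>b. (of_coord b, of_coord 1, of_coord 1)"])
    show "?J p = ?J q" if "(p, q) \<in> ?R" for p q
      using that
      by (auto simp: r_lact r_ract mult.assoc eps_S_left eps_Q_left T_F_left r_in_F
          T_mult[symmetric])
  next
    fix p assume "p \<in> ?X"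
    then obtain x y z where p: "p = (x, y, z)" "x \<in> carrier B" "y \<in> carrier B" "z \<in> carrier B"
      by auto
    \<comment> \<open>First the coordinate of \<open>z\<close> moves into the second factor, giving
      \<open>b\<close>; then \<open>b\<close> moves into the first.\<close>
    define b where "b = \<epsilon> * r y * T (\<epsilon> * r z)"
    have b: "\<epsilon> * r (of_coord b) = b"
      by (simp add: r_of_coord eps_Q_delta)
    have "((x, lb_ract B y (\<epsilon> * r z), of_coord 1), (x, y, lb_lact B (\<epsilon> * r z) (of_coord 1))) \<in> ?R"
      using p of_coord_closed by blast
    then have "((x, of_coord b, of_coord 1), p) \<in> ?R"
      by (simp only: ract_of_coord[OF p(3,4)] lact_of_coord[OF p(4)] p(1) b_def)
    then have 1: "((x, of_coord b, of_coord 1), p) \<in> generated_equiv ?X ?R"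
      by (rule generated_equiv_step) (use p in \<open>auto simp: of_coord_closed\<close>)
    have b': "lb_ract B x b = of_coord (\<epsilon> * r x * T b)" "lb_lact B b (of_coord 1) = of_coord b"
      using ract_of_coord[OF p(2) of_coord_closed[of b]] lact_of_coord[OF of_coord_closed[of b]]
      by (simp_all only: b)
    have "((lb_ract B x b, of_coord 1, of_coord 1), (x, lb_lact B b (of_coord 1), of_coord 1)) \<in> ?R"
      using p of_coord_closed by blast
    then have "((of_coord (\<epsilon> * r x * T b), of_coord 1, of_coord 1), (x, of_coord b, of_coord 1)) \<in> ?R"
      by (simp only: b')
    then have "((of_coord (\<epsilon> * r x * T b), of_coord 1, of_coord 1), (x, of_coord b, of_coord 1))
        \<in> generated_equiv ?X ?R"
      by (rule generated_equiv_step) (use p in \<open>auto simp: of_coord_closed\<close>)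
    from generated_equiv_sym[OF generated_equiv_trans[OF this 1]]
    show "(p, (of_coord (?J p), of_coord 1, of_coord 1)) \<in> generated_equiv ?X ?R"
      by (simp add: p(1) b_def)
  qed
  then show ?thesis
    unfolding pure_tensor3_def using assms by auto
qed

text \<open>The two coordinate formulas are hypotheses because they arise differently: for
  \<open>F\<close> from the explicit definition, for the dual by solving the equation that
  determines the comultiplication. Equalities in \<open>B\<close> are checked through
  \<open>r\<close>.\<close>

lemma left_bialgebroid_B:
  assumes comult: "\<And>f. f \<in> carrier B \<Longrightarrow> comult B f = {(x, y). x \<in> carrier B \<and> y \<in> carrier B \<and>
      \<epsilon> * r x * T (\<epsilon> * r y) = \<epsilon> * r f * \<mu>}"
    and counit: "\<And>f. f \<in> carrier B \<Longrightarrow> counit B f = \<epsilon> * r f * \<eta>"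
  shows "left_bialgebroid B"
proof unfold_locales
  note closed [simp] = mult_closed one_closed src_closed tgt_closed lact_closed ract_closed r_in_F
  note r [simp] = r_mult r_one r_src r_tgt r_lact r_ract
  show "x \<otimes>\<^bsub>B\<^esub> y \<in> carrier B" if "x \<in> carrier B" "y \<in> carrier B" for x y
    using that by simp
  show "\<one>\<^bsub>B\<^esub> \<in> carrier B" "src B a \<in> carrier B" "tgt B a \<in> carrier B" for a
    by simp_all
  show "x \<otimes>\<^bsub>B\<^esub> y \<otimes>\<^bsub>B\<^esub> z = x \<otimes>\<^bsub>B\<^esub> (y \<otimes>\<^bsub>B\<^esub> z)"
    if "x \<in> carrier B" "y \<in> carrier B" "z \<in> carrier B" for x y z
    using that by (intro r_eqI) (simp_all add: mult.assoc)
  show "\<one>\<^bsub>B\<^esub> \<otimes>\<^bsub>B\<^esub> x = x" "x \<otimes>\<^bsub>B\<^esub> \<one>\<^bsub>B\<^esub> = x" if "x \<in> carrier B" for x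
    using that by (intro r_eqI; simp)+
  show "src B 1 = \<one>\<^bsub>B\<^esub>" "tgt B 1 = \<one>\<^bsub>B\<^esub>"
    by (intro r_eqI; simp add: Q_one S_one)+
  show "src B (a * b) = src B a \<otimes>\<^bsub>B\<^esub> src B b" "tgt B (a * b) = tgt B b \<otimes>\<^bsub>B\<^esub> tgt B a"
    "src B a \<otimes>\<^bsub>B\<^esub> tgt B b = tgt B b \<otimes>\<^bsub>B\<^esub> src B a" for a b
    by (intro r_eqI; simp add: Q_mult S_mult S_Q)+
  have tensor_eqI: "comult B f = lb_tensor B x y"
    if "f \<in> carrier B" "x \<in> carrier B" "y \<in> carrier B"
      "\<epsilon> * r x * T (\<epsilon> * r y) = \<epsilon> * r f * \<mu>" for f x y
    using that by (simp add: comult lb_tensor_B)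
  show "comult B \<one>\<^bsub>B\<^esub> = lb_tensor B \<one>\<^bsub>B\<^esub> \<one>\<^bsub>B\<^esub>"
    by (rule tensor_eqI) (simp_all add: eps_mu)
  show "counit B \<one>\<^bsub>B\<^esub> = 1"
    by (simp add: counit eps_eta)
  fix f a b assume f: "f \<in> carrier B"
  show "comult B f \<in> tensor_prod (carrier B) (carrier B) (lb_ract B) (lb_lact B)"
  proof -
    have "comult B f = lb_tensor B (of_coord (\<epsilon> * r f * \<mu>)) (of_coord 1)"
      by (rule tensor_eqI) (simp_all add: f of_coord_closed r_of_coord eps_Q_delta T_one)
    then show ?thesis
      by (simp add: pure_tensor_def tensor_prod_def of_coord_closed quotientI)
  qed
  show "counit B (lb_ract B (lb_lact B a f) b) = a * counit B f * b"
    using f by (simp add: counit mult.assoc eps_S_left T_Q_left eps_Q_left T_F_left T_eta)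
  fix f' assume f': "f' \<in> carrier B"
  have "r f' * \<eta> = Q (\<epsilon> * r f' * \<eta>) * \<eta>"
    using f' by (intro F_eta) simp
  then show "counit B (f \<otimes>\<^bsub>B\<^esub> f') = counit B (f \<otimes>\<^bsub>B\<^esub> src B (counit B f'))"
    "counit B (f \<otimes>\<^bsub>B\<^esub> f') = counit B (f \<otimes>\<^bsub>B\<^esub> tgt B (counit B f'))"
    using f f' by (simp_all add: counit mult.assoc S_eta)
  fix x y assume "(x, y) \<in> comult B f"
  then have xy: "x \<in> carrier B" "y \<in> carrier B" "\<epsilon> * r x * T (\<epsilon> * r y) = \<epsilon> * r f * \<mu>"
    using f by (auto simp: comult)
  show "comult B (lb_ract B (lb_lact B a f) b) = lb_tensor B (lb_lact B a x) (lb_ract B y b)"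
  proof (rule tensor_eqI)
    have "\<epsilon> * (Q a * r x) * T (\<epsilon> * (S b * r y)) = a * (\<epsilon> * r x * T (\<epsilon> * r y)) * T (T b)"
      using xy(1,2) by (simp add: mult.assoc eps_Q_left eps_S_left F_T[symmetric] T_mult)
    also have "\<dots> = a * \<epsilon> * (r f * T b) * \<mu>"
      unfolding xy(3) using f by (simp add: mult.assoc mu_TT F_T_left)
    also have "\<dots> = \<epsilon> * (S b * (Q a * r f)) * \<mu>"
      using f by (simp add: mult.assoc eps_S_left F_T_left T_Q_left eps_Q_left)
    finally show "\<epsilon> * r (lb_lact B a x) * T (\<epsilon> * r (lb_ract B y b)) =
        \<epsilon> * r (lb_ract B (lb_lact B a f) b) * \<mu>"
      using f xy by simp
  qed (use f xy in simp_all)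
  show "lb_lact B (counit B x) y = f"
  proof (rule r_eqI)
    have "\<epsilon> * (Q (\<epsilon> * r x * \<eta>) * r y) = \<epsilon> * r x * T (\<epsilon> * r y) * \<eta>"
      by (simp add: eps_Q_left) (simp add: mult.assoc T_eta)
    also have "\<dots> = \<epsilon> * r f"
      unfolding xy(3) by (simp add: mult.assoc mu_eta)
    finally show "\<epsilon> * r (lb_lact B (counit B x) y) = \<epsilon> * r f"
      using xy by (simp add: counit)
  qed (use f xy in simp_all)
  show "lb_ract B x (counit B y) = f"
  proof (rule r_eqI)
    have "\<epsilon> * (S (\<epsilon> * r y * \<eta>) * r x) = \<epsilon> * r x * T (\<epsilon> * r y) * T \<eta>"
      by (simp only: eps_S_left mult.assoc F_T[OF r_in_F[OF xy(1)], symmetric])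
        (simp only: T_mult mult.assoc)
    also have "\<dots> = \<epsilon> * r f"
      unfolding xy(3) by (simp add: mult.assoc mu_T_eta)
    finally show "\<epsilon> * r (lb_ract B x (counit B y)) = \<epsilon> * r f"
      using xy by (simp add: counit)
  qed (use f xy in simp_all)
  show "lb_tensor B (x \<otimes>\<^bsub>B\<^esub> tgt B a) y = lb_tensor B x (y \<otimes>\<^bsub>B\<^esub> src B a)"
  proof -
    have "\<epsilon> * (r x * S a) * T (\<epsilon> * r y) = \<epsilon> * r x * T (\<epsilon> * r y) * S a"
      by (simp add: mult.assoc S_T)
    also have "\<dots> = \<epsilon> * r x * T (\<epsilon> * r y) * T (Q a)"
      unfolding xy(3) by (simp add: mult.assoc mu_S)
    also have "\<dots> = \<epsilon> * r x * T (\<epsilon> * (r y * Q a))"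
      by (simp add: mult.assoc T_mult)
    finally show ?thesis
      using xy by (simp add: lb_tensor_B)
  qed
  show "comult B (f \<otimes>\<^bsub>B\<^esub> f') = lb_tensor B (x \<otimes>\<^bsub>B\<^esub> x') (y \<otimes>\<^bsub>B\<^esub> y')"
    if "(x', y') \<in> comult B f'" for x' y'
  proof (rule tensor_eqI)
    have xy': "x' \<in> carrier B" "y' \<in> carrier B" "\<epsilon> * r x' * T (\<epsilon> * r y') = \<epsilon> * r f' * \<mu>"
      using f' that by (auto simp: comult)
    then show "x \<otimes>\<^bsub>B\<^esub> x' \<in> carrier B" "y \<otimes>\<^bsub>B\<^esub> y' \<in> carrier B" "f \<otimes>\<^bsub>B\<^esub> f' \<in> carrier B"
      using f f' xy by simp_all
    define u v w where "u = \<epsilon> * r x'" and "v = \<epsilon> * r y'" and "w = \<epsilon> * r f'"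
    have x': "r x' = Q u * \<delta>" and y': "r y' = Q v * \<delta>" and fw: "r f' = Q w * \<delta>"
      using F_normal xy' f' r_in_F unfolding u_def v_def w_def by auto
    have uv: "u * T v = w * \<mu>"
      using xy'(3) by (simp add: u_def v_def w_def)
    \<comment> \<open>The coordinate equation of \<open>f'\<close> is strengthened by cancelling
      \<open>\<epsilon>\<close> on the left, as for \<open>G\<close> it was by cancelling
      \<open>\<eta>\<close> on the right; the key is again
      \<open>Q_mu_gamma_T_delta\<close>.\<close>
    have "\<mu> * r x' * T (r y') = Q u * (\<gamma> * T (Q v)) * T \<delta>"
      by (simp add: x' y' T_mult mult.assoc mu_Q_left mu_delta_left)
    also have "\<dots> = Q (u * T v) * \<gamma> * T \<delta>"
      by (simp add: gamma_TQ Q_mult mult.assoc)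
    also have "\<dots> = r f' * \<mu>"
      by (simp add: uv fw Q_mult mult.assoc) (simp add: mult.assoc[symmetric] Q_mu_gamma_T_delta[symmetric])
    finally have *: "\<mu> * r x' * T (r y') = r f' * \<mu>" .
    have "\<epsilon> * (r x * r x') * T (\<epsilon> * (r y * r y')) = \<epsilon> * r x * T (\<epsilon> * r y) * r x' * T (r y')"
      using xy' by (simp add: mult.assoc[symmetric] T_mult) (simp add: mult.assoc F_T_left)
    also have "\<dots> = \<epsilon> * r f * (\<mu> * r x' * T (r y'))"
      unfolding xy(3) by (simp add: mult.assoc)
    also have "\<dots> = \<epsilon> * (r f * r f') * \<mu>"
      unfolding * by (simp add: mult.assoc)
    finally show "\<epsilon> * r (x \<otimes>\<^bsub>B\<^esub> x') * T (\<epsilon> * r (y \<otimes>\<^bsub>B\<^esub> y')) = \<epsilon> * r (f \<otimes>\<^bsub>B\<^esub> f') * \<mu>"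
      using xy(1,2) xy'(1,2) f f' by simp
  qed
  fix x1 x2 u v v1 v2
  assume "(x1, x2) \<in> comult B x" "(u, v) \<in> comult B f" "(v1, v2) \<in> comult B v"
  then have c: "x1 \<in> carrier B" "x2 \<in> carrier B" "u \<in> carrier B" "v \<in> carrier B"
      "v1 \<in> carrier B" "v2 \<in> carrier B"
    and e: "\<epsilon> * r x1 * T (\<epsilon> * r x2) = \<epsilon> * r x * \<mu>" "\<epsilon> * r u * T (\<epsilon> * r v) = \<epsilon> * r f * \<mu>"
      "\<epsilon> * r v1 * T (\<epsilon> * r v2) = \<epsilon> * r v * \<mu>"
    using f xy by (auto simp: comult)
  \<comment> \<open>Both iterations have coordinate \<open>\<epsilon> * r f * \<mu> * \<mu>\<close>,
    by \<open>mu_TT\<close> on one side and \<open>mu_mu\<close> on the other.\<close>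
  have "\<epsilon> * r x1 * T (\<epsilon> * r x2 * T (\<epsilon> * r y)) = \<epsilon> * r x1 * T (\<epsilon> * r x2) * T (T (\<epsilon> * r y))"
    by (simp add: T_mult mult.assoc)
  also have "\<dots> = \<epsilon> * r x * T (\<epsilon> * r y) * \<mu>"
    unfolding e(1) by (simp add: mult.assoc mu_TT)
  also have "\<dots> = \<epsilon> * r u * T (\<epsilon> * r v) * T \<mu>"
    unfolding xy(3) e(2) by (simp add: mult.assoc mu_mu)
  also have "\<dots> = \<epsilon> * r u * T (\<epsilon> * r v1 * T (\<epsilon> * r v2))"
    unfolding e(3) by (simp add: T_mult mult.assoc)
  finally show "lb_tensor3 B x1 x2 y = lb_tensor3 B u v1 v2"
    using c xy by (simp add: lb_tensor3_B)
qed

end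

context skew_monoidal_monoid
begin

lemma F_model_F: "F_model T Q \<gamma> \<eta> \<epsilon> F id"
  by unfold_locales
    (simp_all add: mult_F one_F src_F tgt_F F_mult_closed one_in_F Q_in_F S_in_F)

lemma comult_F:
  "comult F f = {(x, y). x \<in> carrier F \<and> y \<in> carrier F \<and>
     \<epsilon> * x * T (\<epsilon> * y) = \<epsilon> * f * \<mu>}"
proof -
  interpret F: F_model T Q \<gamma> \<eta> \<epsilon> F id by (rule F_model_F)
  show ?thesis
    unfolding comult_F_tensor
    by (simp add: F.lb_tensor_B Q_delta_in_F delta_in_F eps_Q_delta eps_delta T_one)
qed

section \<open>The left dual of \<open>G\<close>\<close>

text \<open>The functional obtained by pairing with \<open>Q a * \<delta>\<close>, the element of
  \<open>F\<close> with coordinate \<open>a\<close>.\<close>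

definition dual_elem :: "'a \<Rightarrow> 'a \<Rightarrow> 'a" where
  "dual_elem a = (\<lambda>g\<in>carrier G. a * g * \<eta>)"

lemma dual_elem_apply: "g \<in> carrier G \<Longrightarrow> dual_elem a g = a * g * \<eta>"
  by (simp add: dual_elem_def)

lemma dual_elem_mu: "dual_elem a \<mu> = a"
  by (simp add: dual_elem_apply mu_in_G mult.assoc mu_eta)

lemma dual_elem_in: "dual_elem a \<in> dual_carrier G"
  by (auto simp: dual_carrier_def dual_elem_apply rb_ract_G G_mult_closed T_in_G mult.assoc T_eta)
    (simp add: dual_elem_def)

lemma dual_elem_of:
  assumes "\<phi> \<in> dual_carrier G"
  shows "\<phi> = dual_elem (\<phi> \<mu>)"
proof (rule extensionalityI)
  show "\<phi> \<in> extensional (carrier G)" "dual_elem (\<phi> \<mu>) \<in> extensional (carrier G)"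
    using assms by (auto simp: dual_carrier_def dual_elem_def)
  fix g assume g: "g \<in> carrier G"
  have "\<phi> (\<mu> * T (g * \<eta>)) = \<phi> \<mu> * (g * \<eta>)"
    using assms mu_in_G by (auto simp: dual_carrier_def rb_ract_G)
  then show "\<phi> g = dual_elem (\<phi> \<mu>) g"
    using G_normal[OF g] g by (simp add: dual_elem_apply mult.assoc)
qed

text \<open>The right side no longer mentions \<open>g1\<close> and \<open>g2\<close>: the
  convolution does not depend on the representative of the comultiplication. The product rule of the
  pairing rests on the same computation.\<close>

lemma pair_act:
  assumes "g2 \<in> carrier G" "Q (g1 * \<eta>) * g2 * \<eta> = \<delta> * g * \<eta>"
  shows "a * (g2 * S (b * g1 * \<eta>)) * \<eta> = a * Q b * \<delta> * g * \<eta>"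
proof -
  have "a * (g2 * S (b * g1 * \<eta>)) * \<eta> = a * Q b * (Q (g1 * \<eta>) * g2 * \<eta>)"
    using assms(1) by (simp add: mult.assoc S_eta G_Q_left Q_mult)
  then show ?thesis by (simp add: assms(2)) (simp add: mult.assoc)
qed

lemma dual_mult_elem: "dual_mult G (dual_elem a) (dual_elem b) = dual_elem (a * Q b * \<delta>)"
proof -
  have "tensor_lift (\<lambda>g1 g2. dual_elem a (rb_lact G (dual_elem b g1) g2)) (comult G g)
      = a * Q b * \<delta> * g * \<eta>" for g
  proof -
    have "(\<lambda>(g1, g2). dual_elem a (rb_lact G (dual_elem b g1) g2)) ` comult G g
        = (\<lambda>_. a * Q b * \<delta> * g * \<eta>) ` comult G g"
      by (rule image_cong)
        (auto simp: comult_G rb_lact_G dual_elem_apply G_mult_closed S_in_G pair_act)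
    \<comment> \<open>The class is not empty, so the image under the constant function is a
      singleton.\<close>
    moreover have "(\<mu>, \<mu> * T (\<delta> * g * \<eta>)) \<in> comult G g"
      by (simp add: comult_G mu_in_G mu_T_in_G mu_eta Q_one mult.assoc T_eta mu_eta_left)
    ultimately show ?thesis
      unfolding tensor_lift_def by (metis empty_iff image_constant the_elem_eq)
  qed
  then show ?thesis
    by (simp add: dual_mult_def dual_elem_def[of "a * Q b * \<delta>"] cong: restrict_cong)
qed

lemma dual_one: "restrict (counit G) (carrier G) = dual_elem \<epsilon>"
  and dual_src_elem: "dual_src G a = dual_elem (a * \<epsilon>)"
  and dual_tgt_elem: "dual_tgt G a = dual_elem (\<epsilon> * T a)"
  by (auto simp: dual_src_def dual_tgt_def dual_elem_def counit_G src_G mult_G mult.assoc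
      cong: restrict_cong)

lemma left_dual_simps:
  "carrier (left_dual G) = dual_carrier G"
  "mult (left_dual G) = dual_mult G"
  "\<one>\<^bsub>left_dual G\<^esub> = dual_elem \<epsilon>"
  "src (left_dual G) = dual_src G"
  "tgt (left_dual G) = dual_tgt G"
  "comult (left_dual G) = (\<lambda>\<phi>. THE X. is_dual_comult G \<phi> X)"
  "counit (left_dual G) \<phi> = \<phi> 1"
  by (simp_all add: left_dual_def dual_one one_G)

text \<open>Inverse to the map that sends \<open>f\<close> to its functional, since that functional
  takes the value \<open>\<epsilon> * f\<close> at \<open>\<mu>\<close>.\<close>

definition dual_rep :: "('a \<Rightarrow> 'a) \<Rightarrow> 'a" where
  "dual_rep \<phi> = Q (\<phi> \<mu>) * \<delta>"

lemma dual_rep_elem: "dual_rep (dual_elem a) = Q a * \<delta>"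
  by (simp add: dual_rep_def dual_elem_mu)

lemma dual_rep_in_F: "dual_rep \<phi> \<in> carrier F"
  unfolding dual_rep_def by (rule Q_delta_in_F)

lemma dual_elem_rep: "\<phi> \<in> dual_carrier G \<Longrightarrow> dual_elem (\<epsilon> * dual_rep \<phi>) = \<phi>"
  by (simp add: dual_rep_def eps_Q_delta dual_elem_of[symmetric])

lemma F_model_dual: "F_model T Q \<gamma> \<eta> \<epsilon> (left_dual G) dual_rep"
proof unfold_locales
  show "bij_betw dual_rep (carrier (left_dual G)) (carrier F)"
    by (rule bij_betw_byWitness[where f' = "\<lambda>f. dual_elem (\<epsilon> * f)"])
      (auto simp: left_dual_simps dual_elem_rep dual_elem_in dual_rep_elem F_normal[symmetric]
        dual_rep_in_F)
  show "\<one>\<^bsub>left_dual G\<^esub> \<in> carrier (left_dual G)" "dual_rep \<one>\<^bsub>left_dual G\<^esub> = 1"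
    by (simp_all add: left_dual_simps dual_elem_in dual_rep_elem Q_eps_delta)
  show "src (left_dual G) a \<in> carrier (left_dual G)" "dual_rep (src (left_dual G) a) = Q a"
    "tgt (left_dual G) a \<in> carrier (left_dual G)" "dual_rep (tgt (left_dual G) a) = S a" for a
    by (simp_all add: left_dual_simps dual_elem_in dual_src_elem dual_tgt_elem dual_rep_elem
        S_delta_form Q_mult mult.assoc Q_eps_delta)
  fix \<phi> \<psi> assume "\<phi> \<in> carrier (left_dual G)" "\<psi> \<in> carrier (left_dual G)"
  then obtain a b where ab: "\<phi> = dual_elem a" "\<psi> = dual_elem b"
    by (metis dual_elem_of left_dual_simps(1))
  show "\<phi> \<otimes>\<^bsub>left_dual G\<^esub> \<psi> \<in> carrier (left_dual G)"
    "dual_rep (\<phi> \<otimes>\<^bsub>left_dual G\<^esub> \<psi>) = dual_rep \<phi> * dual_rep \<psi>"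
    by (simp_all add: ab left_dual_simps dual_mult_elem dual_elem_in dual_rep_elem
        Q_mult mult.assoc delta_Q_left delta_delta)
qed

section \<open>The comultiplication of the dual\<close>

lemma dual_act:
  "dual_ract G = lb_ract (left_dual G)" "dual_lact G = lb_lact (left_dual G)"
  by (simp_all add: fun_eq_iff lb_ract_def lb_lact_def dual_ract_def dual_lact_def left_dual_simps)

text \<open>With \<open>a\<close>, \<open>a1\<close>, \<open>a2\<close> the values at
  \<open>\<mu>\<close>, both sides of the defining equation end in the factor
  \<open>T (g * \<eta>) * g' * \<eta>\<close>, preceded by \<open>a * \<mu>\<close> and
  \<open>a1 * T a2\<close>. At \<open>g = g' = \<mu>\<close> the common factor is \<open>1\<close>,
  so it can be cancelled.\<close>

lemma is_dual_comult_iff: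
  assumes \<phi>: "\<phi> \<in> dual_carrier G"
    and X: "X \<in> tensor_prod (dual_carrier G) (dual_carrier G) (dual_ract G) (dual_lact G)"
      "X \<subseteq> dual_carrier G \<times> dual_carrier G"
  shows "is_dual_comult G \<phi> X \<longleftrightarrow>
    (\<forall>(\<phi>1, \<phi>2)\<in>X. \<epsilon> * dual_rep \<phi>1 * T (\<epsilon> * dual_rep \<phi>2) = \<epsilon> * dual_rep \<phi> * \<mu>)"
proof -
  have "(\<forall>g\<in>carrier G. \<forall>g'\<in>carrier G. \<phi> (g \<otimes>\<^bsub>G\<^esub> g') = dual_ract G \<phi>1 (\<phi>2 g) g') \<longleftrightarrow>
      \<epsilon> * dual_rep \<phi>1 * T (\<epsilon> * dual_rep \<phi>2) = \<epsilon> * dual_rep \<phi> * \<mu>" (is "?L \<longleftrightarrow> ?R")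
    if \<phi>12: "\<phi>1 \<in> dual_carrier G" "\<phi>2 \<in> dual_carrier G" for \<phi>1 \<phi>2
  proof -
    obtain a a1 a2 where a: "\<phi> = dual_elem a" "\<phi>1 = dual_elem a1" "\<phi>2 = dual_elem a2"
      using dual_elem_of[OF \<phi>] dual_elem_of[OF \<phi>12(1)] dual_elem_of[OF \<phi>12(2)] by blast
    have lhs: "\<phi> (g \<otimes>\<^bsub>G\<^esub> g') = a * \<mu> * (T (g * \<eta>) * g' * \<eta>)"
      if "g \<in> carrier G" "g' \<in> carrier G" for g g'
    proof -
      have "\<phi> (g \<otimes>\<^bsub>G\<^esub> g') = a * g * g' * \<eta>"
        using that by (simp add: a mult_G dual_elem_apply G_mult_closed mult.assoc)
      also have "\<dots> = a * (\<mu> * T (g * \<eta>)) * g' * \<eta>"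
        by (simp only: G_normal[OF that(1), symmetric])
      finally show ?thesis by (simp add: mult.assoc)
    qed
    have rhs: "dual_ract G \<phi>1 (\<phi>2 g) g' = a1 * T a2 * (T (g * \<eta>) * g' * \<eta>)"
      if "g \<in> carrier G" "g' \<in> carrier G" for g g'
    proof -
      have "dual_ract G \<phi>1 (\<phi>2 g) g' = \<epsilon> * T (a2 * g * \<eta>) * (Q a1 * \<delta>) * g' * \<eta>"
        using that by (simp add: a dual_ract_def dual_tgt_elem dual_mult_elem dual_elem_apply mult.assoc)
      also have "\<dots> = \<epsilon> * (Q a1 * \<delta>) * T (a2 * g * \<eta>) * g' * \<eta>"
        by (simp add: mult.assoc T_Q_left delta_T_left)
      also have "\<dots> = a1 * T (a2 * (g * \<eta>)) * g' * \<eta>"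
        by (simp only: eps_Q_delta) (simp add: mult.assoc)
      finally show ?thesis
        by (simp add: T_mult mult.assoc)
    qed
    have R: "?R \<longleftrightarrow> a1 * T a2 = a * \<mu>"
      by (simp add: a dual_rep_elem eps_Q_delta)
    show ?thesis
    proof
      assume ?L
      then have "\<phi> (\<mu> \<otimes>\<^bsub>G\<^esub> \<mu>) = dual_ract G \<phi>1 (\<phi>2 \<mu>) \<mu>"
        using mu_in_G by blast
      then show ?R
        unfolding R using mu_in_G by (simp add: lhs rhs mu_eta T_one)
    next
      assume ?R
      then show ?L
        unfolding R by (simp add: lhs rhs)
    qed
  qed
  then show ?thesis
    using X unfolding is_dual_comult_def by fast
qed

text \<open>The equation of coordinates cuts out exactly one tensor class, which yields existence
  and uniqueness together.\<close>

lemma is_dual_comult_unique: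
  assumes \<phi>: "\<phi> \<in> dual_carrier G"
  shows "is_dual_comult G \<phi> X \<longleftrightarrow>
    X = {(x, y). x \<in> dual_carrier G \<and> y \<in> dual_carrier G \<and>
      \<epsilon> * dual_rep x * T (\<epsilon> * dual_rep y) = \<epsilon> * dual_rep \<phi> * \<mu>}"
    (is "_ \<longleftrightarrow> X = ?X")
proof -
  interpret D: F_model T Q \<gamma> \<eta> \<epsilon> "left_dual G" dual_rep by (rule F_model_dual)
  note tensor = D.lb_tensor_B[unfolded left_dual_simps(1)]
  have "?X = lb_tensor (left_dual G) (dual_elem (\<phi> \<mu> * \<mu>)) (dual_elem 1)"
    by (simp add: left_dual_simps(1) tensor dual_elem_in dual_rep_elem)
      (simp add: dual_rep_def eps_Q_delta T_one)
  then have X_in: "?X \<in> tensor_prod (dual_carrier G) (dual_carrier G) (dual_ract G) (dual_lact G)"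
    by (simp add: dual_act pure_tensor_def tensor_prod_def left_dual_simps(1) dual_elem_in quotientI)
  show ?thesis
  proof
    assume "X = ?X"
    then show "is_dual_comult G \<phi> X"
      using is_dual_comult_iff[OF \<phi> X_in] by auto
  next
    assume X: "is_dual_comult G \<phi> X"
    then have X_tp: "X \<in> tensor_prod (dual_carrier G) (dual_carrier G) (dual_ract G) (dual_lact G)"
      by (simp add: is_dual_comult_def)
    then obtain x y where xy: "x \<in> dual_carrier G" "y \<in> dual_carrier G"
        "X = lb_tensor (left_dual G) x y"
      by (metis D.tensor_prod_B dual_act left_dual_simps(1))
    then have X_eq: "X = {(x', y'). x' \<in> dual_carrier G \<and> y' \<in> dual_carrier G \<and>
        \<epsilon> * dual_rep x' * T (\<epsilon> * dual_rep y') = \<epsilon> * dual_rep x * T (\<epsilon> * dual_rep y)}"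
      by (simp only: left_dual_simps(1) tensor)
    \<comment> \<open>A tensor class contains the pair that names it, so the condition on all pairs
      in \<open>X\<close> is not vacuous and fixes the coordinate of \<open>X\<close>.\<close>
    then have "(x, y) \<in> X"
      using xy by simp
    moreover have "X \<subseteq> dual_carrier G \<times> dual_carrier G"
      using X_eq by auto
    ultimately have "\<epsilon> * dual_rep x * T (\<epsilon> * dual_rep y) = \<epsilon> * dual_rep \<phi> * \<mu>"
      using is_dual_comult_iff[OF \<phi> X_tp] X by blast
    then show "X = ?X"
      by (simp add: X_eq)
  qed
qed

lemma comult_left_dual:
  assumes "\<phi> \<in> dual_carrier G"
  shows "comult (left_dual G) \<phi> = {(x, y). x \<in> dual_carrier G \<and> y \<in> dual_carrier G \<and>
      \<epsilon> * dual_rep x * T (\<epsilon> * dual_rep y) = \<epsilon> * dual_rep \<phi> * \<mu>}"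
  unfolding left_dual_simps using is_dual_comult_unique[OF assms] by (intro the_equality) auto

lemma counit_left_dual:
  assumes "\<phi> \<in> dual_carrier G"
  shows "counit (left_dual G) \<phi> = \<epsilon> * dual_rep \<phi> * \<eta>"
proof -
  have "\<phi> 1 = dual_elem (\<phi> \<mu>) 1"
    using dual_elem_of[OF assms] by simp
  then show ?thesis
    by (simp add: left_dual_simps dual_elem_apply one_in_G dual_rep_def eps_Q_delta)
qed

text \<open>\<open>dual_rep\<close> inverts this map and respects product, unit, source and target
  by \<open>F_model_dual\<close>, so equalities in the dual can be tested on representatives in
  \<open>F\<close>. Both sides are left bialgebroids by the same lemma.\<close>

lemma left_bialgebroid_iso_F_dual:
  "left_bialgebroid_iso F (left_dual G) (\<lambda>f. dual_elem (\<epsilon> * f))"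
proof -
  interpret F: F_model T Q \<gamma> \<eta> \<epsilon> F id by (rule F_model_F)
  interpret D: F_model T Q \<gamma> \<eta> \<epsilon> "left_dual G" dual_rep by (rule F_model_dual)
  let ?h = "\<lambda>f. dual_elem (\<epsilon> * f)"
  have h_in: "?h f \<in> carrier (left_dual G)" for f
    by (simp add: left_dual_simps dual_elem_in)
  have rep_h: "dual_rep (?h f) = f" if "f \<in> carrier F" for f
    using that by (simp add: dual_rep_elem F_normal[symmetric])
  have h_eqI: "?h f = \<phi>" if "f \<in> carrier F" "\<phi> \<in> carrier (left_dual G)" "f = dual_rep \<phi>" for f \<phi>
    using that by (simp add: left_dual_simps dual_elem_rep)
  have "bij_betw ?h (carrier F) (carrier (left_dual G))"
    by (rule bij_betw_byWitness[where f' = dual_rep])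
      (use h_in rep_h D.r_in_F in \<open>auto simp: left_dual_simps dual_elem_rep\<close>)
  moreover have "?h \<in> hom F (left_dual G)"
    by (auto simp: hom_def h_in rep_h D.r_mult mult_F F_mult_closed D.mult_closed intro!: h_eqI)
  moreover have "?h \<one>\<^bsub>F\<^esub> = \<one>\<^bsub>left_dual G\<^esub>"
    by (rule h_eqI) (simp_all add: one_F one_in_F D.one_closed D.r_one)
  moreover have "?h (src F a) = src (left_dual G) a" "?h (tgt F a) = tgt (left_dual G) a" for a
    by (rule h_eqI;
      simp add: src_F tgt_F Q_in_F S_in_F D.src_closed D.tgt_closed D.r_src D.r_tgt)+
  moreover have "comult (left_dual G) (?h f) = lb_tensor (left_dual G) (?h x) (?h y)"
    if "f \<in> carrier F" "(x, y) \<in> comult F f" for f x y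
    using that h_in
    by (auto simp: comult_left_dual comult_F D.lb_tensor_B[unfolded left_dual_simps(1)] rep_h
        left_dual_simps(1))
  moreover have "counit (left_dual G) (?h f) = counit F f" if "f \<in> carrier F" for f
    using that by (simp add: counit_left_dual dual_elem_in rep_h counit_F)
  moreover have "left_bialgebroid F"
    by (rule F.left_bialgebroid_B) (simp_all add: comult_F counit_F)
  moreover have "left_bialgebroid (left_dual G)"
    by (rule D.left_bialgebroid_B)
      (simp_all add: left_dual_simps(1) comult_left_dual counit_left_dual)
  ultimately show ?thesis
    unfolding left_bialgebroid_iso_def iso_def by fast
qed

end

section \<open>The pairing and its compatibilities\<close>

theorem lemma3p3:
  fixes T Q :: "'a::monoid_mult \<Rightarrow> 'a" and \<gamma> \<eta> \<epsilon> :: 'a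
    and G F :: "('a, 'a) bialgebroid" and pair :: "'a \<Rightarrow> 'a \<Rightarrow> 'a"
  assumes smm: "skew_monoidal_monoid T Q \<gamma> \<eta> \<epsilon>"
  defines "G \<equiv> smm_G T Q \<gamma> \<eta> \<epsilon>"
    and "F \<equiv> smm_F T Q \<gamma> \<eta> \<epsilon>"
    and "pair \<equiv> smm_pairing \<eta> \<epsilon>"
  shows
    \<comment> \<open>the left dual of \<open>G\<close> is well defined and identified with \<open>F\<close>\<close>
    "right_bialgebroid G \<and>
     (\<forall>\<phi>\<in>carrier (left_dual G). \<exists>!X. is_dual_comult G \<phi> X) \<and>
     left_bialgebroid_iso F (left_dual G) (\<lambda>f. \<lambda>g\<in>carrier G. pair f g) \<and>
     \<comment> \<open>the pairing is non-degenerate\<close>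
     inj_on (\<lambda>f. \<lambda>g\<in>carrier G. pair f g) (carrier F) \<and>
     inj_on (\<lambda>g. \<lambda>f\<in>carrier F. pair f g) (carrier G) \<and>
     \<comment> \<open>and compatible with the bialgebroid structures\<close>
     (\<forall>f\<in>carrier F. \<forall>g\<in>carrier G. \<forall>a1 a2.
        pair f (rb_ract G (rb_lact G a1 g) a2) = pair (f * Q a1) g * a2) \<and>
     (\<forall>f\<in>carrier F. \<forall>g\<in>carrier G. \<forall>a1 a2.
        pair (lb_ract F (lb_lact F a1 f) a2) g = a1 * pair f (T a2 * g)) \<and>
     (\<forall>f\<in>carrier F. \<forall>g\<in>carrier G. \<forall>g'\<in>carrier G. \<forall>(f1, f2)\<in>comult F f.
        pair f (g * g') = pair (lb_ract F f1 (pair f2 g)) g') \<and>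
     (\<forall>f\<in>carrier F. \<forall>f'\<in>carrier F. \<forall>g\<in>carrier G. \<forall>(g1, g2)\<in>comult G g.
        pair (f * f') g = pair f (rb_lact G (pair f' g1) g2)) \<and>
     (\<forall>f\<in>carrier F. pair f \<one>\<^bsub>G\<^esub> = \<epsilon> * f * \<eta>) \<and>
     (\<forall>g\<in>carrier G. pair \<one>\<^bsub>F\<^esub> g = \<epsilon> * g * \<eta>)"
proof -
  interpret skew_monoidal_monoid T Q \<gamma> \<eta> \<epsilon> by (rule smm)
  have pair: "pair f g = \<epsilon> * f * g * \<eta>" for f g
    by (simp add: pair_def smm_pairing_def)
  have h: "(\<lambda>f. \<lambda>g\<in>carrier G. pair f g) = (\<lambda>f. dual_elem (\<epsilon> * f))"
    by (simp add: fun_eq_iff dual_elem_def pair G_def)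
  have comult_unique: "\<exists>!X. is_dual_comult G \<phi> X" if "\<phi> \<in> carrier (left_dual G)" for \<phi>
    using that by (simp add: G_def left_dual_simps(1) is_dual_comult_unique)
  have iso: "left_bialgebroid_iso F (left_dual G) (\<lambda>f. \<lambda>g\<in>carrier G. pair f g)"
    unfolding h unfolding F_def G_def by (rule left_bialgebroid_iso_F_dual)
  have inj_F: "inj_on (\<lambda>f. \<lambda>g\<in>carrier G. pair f g) (carrier F)"
    using iso unfolding left_bialgebroid_iso_def iso_def bij_betw_def by blast
  have inj_G: "inj_on (\<lambda>g. \<lambda>f\<in>carrier F. pair f g) (carrier G)"
  proof (rule inj_onI)
    fix g g' assume g: "g \<in> carrier G" "g' \<in> carrier G"
      and eq: "(\<lambda>f\<in>carrier F. pair f g) = (\<lambda>f\<in>carrier F. pair f g')"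
    \<comment> \<open>Pairing with \<open>\<delta>\<close> reads off \<open>g * \<eta>\<close>,
      because \<open>\<epsilon> * \<delta> = 1\<close>; this coordinate determines
      \<open>g\<close>.\<close>
    have "pair (smm_delta T \<gamma> \<eta>) g = pair (smm_delta T \<gamma> \<eta>) g'"
      using fun_cong[OF eq, of "smm_delta T \<gamma> \<eta>"] delta_in_F by (simp add: F_def)
    then have "g * \<eta> = g' * \<eta>"
      by (simp add: pair eps_delta)
    then show "g = g'"
      by (rule G_eqI[OF g[unfolded G_def]])
  qed
  have pair_G_act: "pair f (rb_ract G (rb_lact G a1 g) a2) = pair (f * Q a1) g * a2"
    if "g \<in> carrier G" for f g a1 a2
    using that by (simp add: G_def pair rb_ract_G rb_lact_G mult.assoc T_eta S_eta_left G_Q_left)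
  have pair_F_act: "pair (lb_ract F (lb_lact F a1 f) a2) g = a1 * pair f (T a2 * g)"
    if "f \<in> carrier F" for f g a1 a2
    using that
    by (simp add: F_def pair lb_ract_F lb_lact_F mult.assoc eps_S_left T_Q_left eps_Q_left T_F_left)
  have pair_G_mult: "case z of (f1, f2) \<Rightarrow> pair f (g * g') = pair (lb_ract F f1 (pair f2 g)) g'"
    if "g \<in> carrier G" "z \<in> comult F f" for f z g g'
  proof (cases z)
    case (Pair f1 f2)
    have f1: "f1 \<in> carrier F" "\<epsilon> * f1 * T (\<epsilon> * f2) = \<epsilon> * f * smm_mu Q \<gamma> \<epsilon>"
      using that Pair by (auto simp: comult_F F_def)
    \<comment> \<open>The target \<open>S\<close> of \<open>pair f2 g\<close> becomes
      \<open>T\<close> behind \<open>\<epsilon>\<close> and passes \<open>f1\<close>; this assembles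
      the coordinate of the pair \<open>(f1, f2)\<close>, which depends on \<open>f\<close>
      only.\<close>
    have "pair (lb_ract F f1 (pair f2 g)) g' = \<epsilon> * f1 * T (\<epsilon> * f2) * (T (g * \<eta>) * g' * \<eta>)"
      using f1(1)
      by (simp add: F_def pair lb_ract_F mult.assoc eps_S_left T_F_left T_mult)
    also have "\<dots> = \<epsilon> * f * (smm_mu Q \<gamma> \<epsilon> * T (g * \<eta>)) * g' * \<eta>"
      unfolding f1(2) by (simp add: mult.assoc)
    also have "\<dots> = pair f (g * g')"
      by (simp only: G_normal[OF that(1)[unfolded G_def], symmetric]) (simp add: pair mult.assoc)
    finally show ?thesis by (simp add: Pair)
  qed
  have pair_F_mult: "case z of (g1, g2) \<Rightarrow> pair (f * f') g = pair f (rb_lact G (pair f' g1) g2)"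
    if f': "f' \<in> carrier F" and z: "z \<in> comult G g" for f f' g z
  proof (cases z)
    case (Pair g1 g2)
    \<comment> \<open>\<open>pair_act\<close> applied to the coordinates of \<open>f\<close> and
      \<open>f'\<close> makes the normal form of \<open>f'\<close> appear.\<close>
    have "pair f (rb_lact G (pair f' g1) g2) = \<epsilon> * f * (Q (\<epsilon> * f') * smm_delta T \<gamma> \<eta>) * g * \<eta>"
      using z Pair pair_act[of g2 g1 g "\<epsilon> * f" "\<epsilon> * f'"]
      by (simp add: comult_G rb_lact_G pair G_def mult.assoc)
    also have "\<dots> = pair (f * f') g"
      by (simp only: F_normal[OF f'[unfolded F_def], symmetric]) (simp add: pair mult.assoc)
    finally show ?thesis by (simp add: Pair)
  qed
  have pair_one: "pair f \<one>\<^bsub>G\<^esub> = \<epsilon> * f * \<eta>" "pair \<one>\<^bsub>F\<^esub> g = \<epsilon> * g * \<eta>" for f g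
    by (simp_all add: pair one_G one_F G_def F_def)
  have bialg: "right_bialgebroid G"
    unfolding G_def by (rule right_bialgebroid_G)
  show ?thesis
    by (intro conjI ballI allI;
      rule bialg comult_unique iso inj_F inj_G pair_G_act pair_F_act pair_G_mult pair_F_mult pair_one;
      assumption)
qed

end
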